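(* Let $m\in\mathbb{Z}$ and let $f_0$ be a density function on $\mathbb{R}$ (real-valued, in $L^1(\mathbb{R})$, piecewise $C^1$) whose Fourier transform can be extended to $\mathbb{C}\setminus(\gamma_{u_1}\cup\dots\cup\gamma_{u_N})$ as $\hat f_0=Z+H$, where $H$ is entire and $Z$ has $N$ algebraic or logarithmic branch points $u_1,\dots,u_N\in\mathbb{C}\setminus\mathbb{R}$ of orders $\rho_1,\dots,\rho_N\in\mathbb{C}\setminus\{0\}$. Suppose that: (i) $\hat f_0$ has at most polynomial growth: $|\hat f_0(u)|\le C(1+|u|^q)$ for some $C,q>0$; (ii) there is $\theta\in(0,\frac\pi2)$ such that $\sup_{u\in\gamma(R,\theta)}(|\hat f_0(u)|+|\hat f_0(-u)|)$ and $\sup_{u\in\gamma(-R,\pi-\theta)}(|\hat f_0(u)|+|\hat f_0(-u)|)$ tend to zero as $R\to+\infty$; (iii) the singularities of $\hat f_0$ nearest to the real axis in the upper and lower half-planes have imaginary parts $b>0$ and $-a<0$ and maximal orders $\gamma^+>0$ and $\gamma^->0$, respectively: $\operatorname{Im}(u_n)>0$ implies $\operatorname{Im}(u_n)\ge b$, and $\operatorname{Im}(u_n)=b$ implies $\operatorname{Re}(\rho_n)\le\gamma^+$; $\operatorname{Im}(u_n)<0$ implies $\operatorname{Im}(u_n)\le-a$, and $\operatorname{Im}(u_n)=-a$ implies $\operatorname{Re}(\rho_n)\le\gamma^-$; (iv) with $r=2^m\pi$ and for some integer $M\ge0$, $\hat f_0\in C^{M+1}(\{|u|>r\})$, $\lim_{|u|\to\infty}\hat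 f_0^{(j)}(u)=0$ for $0\le j\le M$, and $\hat f_0^{(M+1)}\in L^1(\{|u|>r\})$. Let $-a<\alpha<b$, $\mu\in\mathbb{R}$, $f(y):=f_0(y-\mu)$, $f_\alpha(y):=e^{\alpha y}f_0(y-\mu)$, and for $k\in\mathbb{Z}$ let $y_k:=k/2^m$ and $y_{k,\mu}:=y_k-\mu$. Then, for some constants $C_+,C_->0$, the Shannon coefficients $D^\alpha_{m,k}$ of $f_\alpha$ satisfy, up to an additional $O(y_{k,\mu}^{-2})$ term, $$|D^\alpha_{m,k}|\le 2^{-m/2}\begin{cases} C_+e^{\alpha\mu}\,y_{k,\mu}^{\gamma^+-1}e^{-(b-\alpha)y_{k,\mu}}+\varepsilon_D(m)\,y_{k,\mu}^{-1}, & y_{k,\mu}>1,\\ C_-e^{\alpha\mu}\,|y_{k,\mu}|^{\gamma^--1}e^{-(a+\alpha)|y_{k,\mu}|}+\varepsilon_D(m)\,|y_{k,\mu}|^{-1}, & y_{k,\mu}<-1,\end{cases}$$ where $\varepsilon_D(m)=\frac1\pi|\operatorname{Im}[\hat f_\alpha(2^m\pi)]|=\frac1\pi|\operatorname{Im}[\hat f(2^m\pi+\mathrm{i}\alpha)]|$.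
   Context: The Fourier transform is $\hat h(z)=\int_{\mathbb{R}}h(y)e^{-\mathrm{i}zy}\,dy$, so $\hat f_\alpha(u)=\hat f(u+\mathrm{i}\alpha)$. The Shannon coefficients are $$D^\alpha_{m,k}=\int_{\mathbb{R}}f_\alpha(y)\phi_{m,k}(y)\,dy=\frac{2^{-m/2}}{2\pi}\int_{-2^m\pi}^{2^m\pi}\hat f_\alpha(u)e^{\mathrm{i}ku/2^m}\,du,\qquad \phi_{m,k}(y)=2^{m/2}\operatorname{sinc}(2^my-k),\ \operatorname{sinc}(x)=\tfrac{\sin\pi x}{\pi x}.$$ A property holds piecewise if there is a finite partition of $\mathbb{R}$ into intervals on each of which it holds. $\operatorname{sgn}(t)=1$ for $t\ge0$ and $-1$ for $t<0$. For $u_0\in\mathbb{C}$ and $\theta\in(0,\pi)$, $\gamma(u_0,\theta)$ is the half-line $\{u_0+\operatorname{sgn}(\operatorname{Im}u_0)e^{\mathrm{i}\theta}t:\ t>0\}$. The half-line $\gamma_{u_0}:=\gamma(u_0,\frac\pi2)$ is the branch cut starting at the branch point $u_0$. On the plane slit along the cut a branch of $\log(u-u_0)$ is fixed, so that $(u-u_0)^{-\rho}$ is well defined for $\rho\in\mathbb{C}$. A function $Z$ on the plane slit along $\gamma_{u_1},\dots,\gamma_{u_N}$ has algebraic branch points $u_1,\dots,u_N$ of orders $\rho_1,\dots,\rho_N\in\mathbb{C}\setminus\{0\}$ if $Z(u)=g(u)\prod_{n=1}^N(u-u_n)^{-\rho_n}$ with $g$ entire; then $(u-u_n)^{\rho_n}Z(u)$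 is analytic in a ball around $u_n$, and $u_n$ is a pole of order $\rho_n$ when $\rho_n\in\mathbb{N}$. If close to some branch point $u_n$ one has instead $Z(u)=(u-u_n)^{-\rho}\log(u-u_n)\,g(u)$ with $-\rho\in\mathbb{N}$ and $g$ analytic there, the branch point is called logarithmic of order $\rho$. *)

theory Defs
  imports "HOL-Analysis.Analysis"
begin

definition fourier :: "(real \<Rightarrow> real) \<Rightarrow> complex \<Rightarrow> complex" where
  "fourier h z = (LINT y|lborel. complex_of_real (h y) * exp (- (\<i> * z * complex_of_real y)))"

definition nsinc :: "real \<Rightarrow> real" where
  "nsinc x = (if x = 0 then 1 else sin (pi * x) / (pi * x))"

definition shannon_scaling :: "int \<Rightarrow> int \<Rightarrow> real \<Rightarrow> real" where
  "shannon_scaling m k y = 2 powr (real_of_int m / 2) * nsinc (2 powi m * y - real_of_int k)"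

definition shannon_coeff :: "int \<Rightarrow> int \<Rightarrow> (real \<Rightarrow> real) \<Rightarrow> real" where
  "shannon_coeff m k h = (LINT y|lborel. h y * shannon_scaling m k y)"

definition piecewise :: "(real set \<Rightarrow> bool) \<Rightarrow> bool" where
  "piecewise P \<longleftrightarrow>
     (\<exists>\<I>. finite \<I> \<and> partition_on UNIV \<I> \<and> (\<forall>I\<in>\<I>. is_interval I \<and> P I))"

(* Derivatives are one-sided at endpoints belonging to the interval. *)
definition C1_on_interval :: "(real \<Rightarrow> real) \<Rightarrow> real set \<Rightarrow> bool" where
  "C1_on_interval h I \<longleftrightarrow>
     (\<exists>h'. continuous_on I h' \<and> (\<forall>x\<in>I. (h has_real_derivative h' x) (at x within I)))"

definition iter_deriv :: "nat \<Rightarrow> (real \<Rightarrow> complex) \<Rightarrow> real \<Rightarrow> complex" where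
  "iter_deriv j h = ((\<lambda>g x. vector_derivative g (at x)) ^^ j) h"

(* Intended for open S only, since all derivatives are two-sided. *)
definition Ck_on :: "nat \<Rightarrow> (real \<Rightarrow> complex) \<Rightarrow> real set \<Rightarrow> bool" where
  "Ck_on k h S \<longleftrightarrow>
     (\<forall>j<k. \<forall>x\<in>S. (iter_deriv j h has_vector_derivative iter_deriv (Suc j) h x) (at x)) \<and>
     continuous_on S (iter_deriv k h)"

(* Unlike sgn of the library, this has value 1 at 0. *)
definition sgn_right :: "real \<Rightarrow> real" where
  "sgn_right t = (if t \<ge> 0 then 1 else -1)"

definition half_line :: "complex \<Rightarrow> real \<Rightarrow> complex set" where
  "half_line u0 \<theta> = {u0 + complex_of_real (sgn_right (Im u0)) * cis \<theta> * complex_of_real t | t. t > 0}"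

definition branch_cut :: "complex \<Rightarrow> complex set" where
  "branch_cut u0 = half_line u0 (pi / 2)"

(* The half-lines do not contain their starting points, at which a function with branch points
   in U has no value in general; so these points are removed as well. *)
definition slit_plane :: "complex set \<Rightarrow> complex set" where
  "slit_plane U = - (\<Union>u0\<in>U. insert u0 (branch_cut u0))"

definition log_branch :: "complex \<Rightarrow> (complex \<Rightarrow> complex) \<Rightarrow> bool" where
  "log_branch u0 L \<longleftrightarrow>
     L holomorphic_on slit_plane {u0} \<and> (\<forall>u\<in>slit_plane {u0}. exp (L u) = u - u0)"

(* With L a branch of log (u - u0), this is (u - u0)^s. *)
definition branch_power :: "(complex \<Rightarrow> complex) \<Rightarrow> complex \<Rightarrow> complex \<Rightarrow> complex" where
  "branch_power L s u = exp (s * L u)"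

(* Z has the branch points u n of orders rho n for n in A; the logarithmic ones are those with n
   in S, the others are algebraic. L n is the chosen branch of log (w - u n). If S is empty, then
   slit_plane (u ` S) is the whole plane, g is entire, and Z = g * (product of the powers) is the
   definition of algebraic branch points. A logarithmic point contributes no power to the
   product: g is singular along its cut, and Z has the logarithmic form close to it. *)
definition has_branch_points ::
  "nat set \<Rightarrow> (nat \<Rightarrow> complex) \<Rightarrow> (nat \<Rightarrow> complex) \<Rightarrow> (nat \<Rightarrow> complex \<Rightarrow> complex)
     \<Rightarrow> (complex \<Rightarrow> complex) \<Rightarrow> bool" where
  "has_branch_points A u \<rho> L Z \<longleftrightarrow> inj_on u A \<and>
     (\<exists>S\<subseteq>A. \<exists>g. g holomorphic_on slit_plane (u ` S) \<and>
        (\<forall>w\<in>slit_plane (u ` A). Z w = g w * (\<Prod>n\<in>A - S. branch_power (L n) (- \<rho> n) w)) \<and>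
        (\<forall>n\<in>S. - \<rho> n \<in> \<nat> \<and>
           (\<exists>e>0. \<exists>h. h holomorphic_on ball (u n) e \<and>
              (\<forall>w\<in>ball (u n) e \<inter> slit_plane (u ` A).
                 Z w = branch_power (L n) (- \<rho> n) w * L n w * h w))))"

end

theory Submission
  imports Defs "HOL-Real_Asymp.Real_Asymp" "HOL-Probability.Probability"
    "HOL-Complex_Analysis.Complex_Analysis"
begin

text \<open>
  The exponential term of the bound is nonnegative (and itself $O(y^{-2})$), so it suffices to bound
  the coefficient by the $\varepsilon_D$ term up to $O(y^{-2})$. This is elementary once $f_\alpha$ has a finite second
  moment: write $\phi_{m,k}$ as $\pm\sin(rs)/(\pi(t-y))$ up to scaling, where $t=s-\mu$, and expand
  $1/(t-y)=-1/y-t/y^2+t^2/(y^2(t-y))$. The first term integrates to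
  $\mathrm{Im}\,\hat f_\alpha(r)/y$, the others are $O(y^{-2})$.

  The moment condition follows from $|f_0(y)|\le C e^{-\beta y}/y^2$ for all $\beta$ in the strip
  and almost all $y$. After a Gaussian regularisation, $f_0(y)$ is an inverse Fourier integral, whose contour is shifted
  to height $\beta$ and which is then integrated by parts twice. Condition (ii) bounds $\hat f_0$ on
  sectors around the real axis, so Cauchy's inequality gives
  $|\hat f_0''(x+\mathrm{i}\beta)|=O(x^{-2})$ uniformly in the regularisation.
\<close>

subsection \<open>Gaussian regularisation\<close>

text \<open>The Gaussian factor makes the inversion integral absolutely convergent; its width
  parameter \<open>\<sigma>\<close> is removed only at the end, so the constant in the decay bound
  must not depend on \<open>\<sigma>\<close>. Boundedness on a double sector gives no rate of decay
  by itself. The rate comes from the geometry: around \<open>x + i \<beta>\<close> there is room for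
  a disc of radius proportional to \<open>|x|\<close>, so each derivative gains a factor
  \<open>1 / |x|\<close>, and two of them give an integrable majorant. The factor
  \<open>exp (- (\<sigma> w)\<^sup>2 / 2)\<close> has modulus at most 1 wherever
  \<open>|Im w| \<le> |Re w|\<close>, which is why the sectors are taken with slope at most 1. The
  limit in \<open>\<sigma>\<close> recovers the density only at points of continuity; piecewise
  smoothness makes these almost all points. The factor \<open>1 / y\<^sup>2\<close> gives
  integrability of the density tilted by any \<open>\<beta>\<close> of the open strip, and two
  exponents on either side of \<open>\<alpha>\<close> then give the second moment at
  \<open>\<alpha>\<close>.\<close>

lemma fourier_gaussian:
  assumes \<sigma>: "\<sigma> > 0"
  shows "(LINT x|lborel. complex_of_real (exp (- (\<sigma> * x)\<^sup>2 / 2)) * cis ((y - s) * x))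
     = complex_of_real (2 * pi * normal_density y \<sigma> s)"
proof -
  define t where "t = (y - s) / \<sigma>"
  \<comment> \<open>The transform of the Gaussian is taken from the characteristic function of the
    standard normal law, at the rescaled point \<open>t\<close>; substituting
    \<open>\<sigma> * x\<close> undoes the scaling.\<close>
  have "complex_of_real (exp (- t\<^sup>2 / 2)) = char std_normal_distribution t"
    by (simp add: char_std_normal_distribution)
  also have "\<dots> = (LINT x|lborel. std_normal_density x *\<^sub>R cis (t * x))"
    unfolding char_def by (subst integral_density) (auto simp: cis_conv_exp)
  also have "\<dots> = \<sigma> *\<^sub>R (LINT x|lborel. std_normal_density (\<sigma> * x) *\<^sub>R cis (t * (\<sigma> * x)))"
    using lborel_integral_real_affine[of \<sigma> "\<lambda>x. std_normal_density x *\<^sub>R cis (t * x)" 0] \<sigma> by simp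
  also have "(\<lambda>x. std_normal_density (\<sigma> * x) *\<^sub>R cis (t * (\<sigma> * x)))
      = (\<lambda>x. (1 / sqrt (2 * pi)) *\<^sub>R (complex_of_real (exp (- (\<sigma> * x)\<^sup>2 / 2)) * cis ((y - s) * x)))"
    using \<sigma> by (auto simp: std_normal_density_def t_def scaleR_conv_of_real fun_eq_iff)
  finally have "complex_of_real (exp (- t\<^sup>2 / 2)) = (\<sigma> / sqrt (2 * pi)) *\<^sub>R
      (LINT x|lborel. complex_of_real (exp (- (\<sigma> * x)\<^sup>2 / 2)) * cis ((y - s) * x))"
    by simp
  then have "(sqrt (2 * pi) / \<sigma>) *\<^sub>R complex_of_real (exp (- t\<^sup>2 / 2)) = 
      (LINT x|lborel. complex_of_real (exp (- (\<sigma> * x)\<^sup>2 / 2)) * cis ((y - s) * x))"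
    using \<sigma> by simp
  moreover have "sqrt (2 * pi) / \<sigma> * exp (- t\<^sup>2 / 2) = 2 * pi * normal_density y \<sigma> s"
    using \<sigma> by (simp add: normal_density_def t_def real_sqrt_mult power_divide power2_commute field_simps)
  ultimately show ?thesis by (metis of_real_mult scaleR_conv_of_real)
qed

lemma integrable_gaussian:
  fixes \<sigma> :: real
  assumes "\<sigma> > 0"
  shows "integrable lborel (\<lambda>x. exp (- (\<sigma> * x)\<^sup>2 / 2))"
proof -
  have "integrable lborel (\<lambda>x. sqrt (2 * pi * (1 / \<sigma>)\<^sup>2) * normal_density 0 (1 / \<sigma>) x)"
    using assms by (intro integrable_mult_right) auto
  then show ?thesis using assms
    by (simp add: normal_density_def power_divide power_mult_distrib field_simps)
qed

text \<open>Fubini for the kernel \<open>k\<close>, whose modulus is the product of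
  \<open>|f s|\<close> and a Gaussian in \<open>x\<close>. Integrating over \<open>s\<close> first
  produces the transform of \<open>f\<close>; integrating over \<open>x\<close> first produces a
  normal density centred at \<open>y\<close>, so the result is a Gaussian mollification of
  \<open>f\<close>.\<close>

lemma fourier_gaussian_inversion:
  assumes f: "integrable lborel f" and \<sigma>: "\<sigma> > 0"
  shows "integrable lborel (\<lambda>x. fourier f (complex_of_real x) * complex_of_real (exp (- (\<sigma> * x)\<^sup>2 / 2)) * cis (y * x))"
      (is ?I)
    and "(LINT x|lborel. fourier f (complex_of_real x) * complex_of_real (exp (- (\<sigma> * x)\<^sup>2 / 2)) * cis (y * x))
      = complex_of_real (2 * pi * (LINT s|lborel. f s * normal_density y \<sigma> s))" (is ?E)
proof -
  have [measurable]: "f \<in> borel_measurable borel" using f by auto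
  define k where "k = (\<lambda>x s. complex_of_real (f s) * (complex_of_real (exp (- (\<sigma> * x)\<^sup>2 / 2)) * cis ((y - s) * x)))"
  have km: "case_prod k \<in> borel_measurable (lborel \<Otimes>\<^sub>M lborel)"
    unfolding k_def cis_conv_exp by measurable
  have nk: "norm (k x s) = \<bar>f s\<bar> * exp (- (\<sigma> * x)\<^sup>2 / 2)" for x s
    unfolding k_def by (simp add: norm_mult)
  have ki: "integrable (lborel \<Otimes>\<^sub>M lborel) (case_prod k)"
  proof (rule lborel_pair.Fubini_integrable[OF km])
    have "integrable lborel (\<lambda>x. exp (- (\<sigma> * x)\<^sup>2 / 2) * (LINT s|lborel. \<bar>f s\<bar>))"
      by (intro integrable_mult_left integrable_gaussian \<sigma>)
    then show "integrable lborel (\<lambda>x. LINT s|lborel. norm (case (x, s) of (x, s) \<Rightarrow> k x s))"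
      unfolding prod.case nk by (simp add: mult.commute)
    have "integrable lborel (k x)" for x
      unfolding k_def cis_conv_exp
      by (rule Bochner_Integration.integrable_bound[OF f]) (auto simp: norm_mult intro!: mult_left_le)
    then show "AE x in lborel. integrable lborel (\<lambda>s. case (x, s) of (x, s) \<Rightarrow> k x s)" by simp
  qed
  have inner: "(LINT s|lborel. k x s) = fourier f (complex_of_real x) * complex_of_real (exp (- (\<sigma> * x)\<^sup>2 / 2)) * cis (y * x)" for x
  proof -
    have "k x s = (complex_of_real (f s) * exp (- (\<i> * complex_of_real x * complex_of_real s)))
        * (complex_of_real (exp (- (\<sigma> * x)\<^sup>2 / 2)) * cis (y * x))" for s
      unfolding k_def by (simp add: cis_conv_exp flip: exp_add) (simp add: algebra_simps)
    then show ?thesis unfolding fourier_def by (simp only: integral_mult_left_zero) (simp only: mult.assoc)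
  qed
  show ?I
    using lborel_pair.integrable_fst[OF ki] unfolding inner .
  have "(LINT x|lborel. fourier f (complex_of_real x) * complex_of_real (exp (- (\<sigma> * x)\<^sup>2 / 2)) * cis (y * x))
      = (LINT s|lborel. (LINT x|lborel. k x s))"
    unfolding inner[symmetric] by (rule lborel_pair.Fubini_integral[OF ki, symmetric])
  also have "\<dots> = (LINT s|lborel. complex_of_real (f s * (2 * pi * normal_density y \<sigma> s)))"
    unfolding k_def by (simp only: integral_mult_right_zero fourier_gaussian[OF \<sigma>] of_real_mult)
  also have "\<dots> = complex_of_real (LINT s|lborel. f s * (2 * pi * normal_density y \<sigma> s))"
    by (rule integral_complex_of_real)
  also have "(LINT s|lborel. f s * (2 * pi * normal_density y \<sigma> s)) = 2 * pi * (LINT s|lborel. f s * normal_density y \<sigma> s)"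
    by (subst integral_mult_right_zero[symmetric]) (simp only: mult_ac)
  finally show ?E .
qed

text \<open>The inequality \<open>exp z \<ge> z\<close> replaces the Gaussian by
  \<open>2 \<sigma>\<^sup>2 / \<eta>\<^sup>2\<close>, and the normalising factor is at most
  \<open>1 / \<sigma>\<close>. What remains is linear in \<open>\<sigma>\<close>: away from its
  centre the density tends to 0 uniformly.\<close>

lemma normal_density_tail_le:
  assumes "\<sigma> > 0" "\<eta> > 0" "\<eta> \<le> \<bar>s - y\<bar>"
  shows "normal_density y \<sigma> s \<le> 2 * \<sigma> / \<eta>\<^sup>2"
proof -
  define z where "z = (s - y)\<^sup>2 / (2 * \<sigma>\<^sup>2)"
  have zz: "\<eta>\<^sup>2 / (2 * \<sigma>\<^sup>2) \<le> z"
    unfolding z_def using assms power_mono[of \<eta> "\<bar>s - y\<bar>" 2] by (intro divide_right_mono) auto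
  have "exp (- z) = inverse (exp z)" by (rule exp_minus)
  also have "\<dots> \<le> inverse (\<eta>\<^sup>2 / (2 * \<sigma>\<^sup>2))"
    using order_trans[OF zz, of "exp z"] exp_ge_add_one_self[of z] assms by (intro le_imp_inverse_le) auto
  also have "\<dots> = 2 * \<sigma>\<^sup>2 / \<eta>\<^sup>2" by simp
  finally have 1: "exp (- z) \<le> 2 * \<sigma>\<^sup>2 / \<eta>\<^sup>2" .
  have "1 \<le> sqrt (2 * pi)" using pi_gt3 by simp
  then have 2: "1 / sqrt (2 * pi * \<sigma>\<^sup>2) \<le> 1 / \<sigma>"
    using assms by (simp add: real_sqrt_mult field_simps)
  have "normal_density y \<sigma> s = 1 / sqrt (2 * pi * \<sigma>\<^sup>2) * exp (- z)"
    unfolding normal_density_def z_def by simp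
  also have "\<dots> \<le> 1 / \<sigma> * (2 * \<sigma>\<^sup>2 / \<eta>\<^sup>2)"
    using 1 2 assms by (intro mult_mono) auto
  also have "\<dots> = 2 * \<sigma> / \<eta>\<^sup>2" using assms by (simp add: power2_eq_square)
  finally show ?thesis .
qed

text \<open>The density has mass 1, so the error is the integral of \<open>(f s - f y)\<close>
  against it. As \<open>f\<close> is only integrable and may be unbounded, continuity at
  \<open>y\<close> helps near \<open>y\<close> only; the far part needs tail estimates.\<close>

lemma gaussian_approximate_identity:
  assumes f: "integrable lborel f" and cont: "isCont f y"
  shows "((\<lambda>\<sigma>. LINT s|lborel. f s * normal_density y \<sigma> s) \<longlongrightarrow> f y) (at_right 0)"
proof (rule tendstoI)
  fix e :: real assume e: "e > 0"
  have [measurable]: "f \<in> borel_measurable borel" using f by auto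
  obtain \<eta> where \<eta>: "\<eta> > 0" "\<And>s. \<bar>s - y\<bar> < \<eta> \<Longrightarrow> \<bar>f s - f y\<bar> < e / 2"
    using cont e unfolding continuous_at_eps_delta dist_real_def by (meson half_gt_zero)
  define A where "A = (LINT s|lborel. \<bar>f s\<bar>)"
  have bound: "\<bar>(LINT s|lborel. f s * normal_density y \<sigma> s) - f y\<bar>
      \<le> e / 2 + (2 * \<sigma> / \<eta>\<^sup>2 * A + \<bar>f y\<bar> / \<eta>\<^sup>2 * \<sigma>\<^sup>2)" if \<sigma>: "\<sigma> > 0" for \<sigma>
  proof -
    have [simp]: "integrable lborel (normal_density y \<sigma>)" using \<sigma> by simp
    have m2i: "integrable lborel (\<lambda>s. normal_density y \<sigma> s * (s - y)\<^sup>2)"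
      using \<sigma> by (rule integrable_normal_moment)
    have m2: "(LINT s|lborel. normal_density y \<sigma> s * (s - y)\<^sup>2) = \<sigma>\<^sup>2"
      using integral_normal_moment_even[OF \<sigma>, of y 1] by simp
    have bi: "integrable lborel (\<lambda>s. f s * normal_density y \<sigma> s)"
    proof (rule Bochner_Integration.integrable_bound)
      show "integrable lborel (\<lambda>s. (1 / sqrt (2 * pi * \<sigma>\<^sup>2)) * f s)" using f by simp
      show "AE s in lborel. norm (f s * normal_density y \<sigma> s) \<le> norm ((1 / sqrt (2 * pi * \<sigma>\<^sup>2)) * f s)"
        using \<sigma> by (intro AE_I2) (auto simp: normal_density_def abs_mult divide_right_mono mult_left_le)
    qed simp
    \<comment> \<open>One majorant for both regimes: the first term serves near \<open>y\<close>.
      Far away \<open>f s\<close> and \<open>f y\<close> are separated: the uniform tail bound meets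
      the integrable \<open>f\<close>, and a Chebyshev estimate with the variance
      \<open>\<sigma>\<^sup>2\<close> meets the constant \<open>f y\<close>.\<close>
    define w where "w = (\<lambda>s. e / 2 * normal_density y \<sigma> s + (2 * \<sigma> / \<eta>\<^sup>2 * \<bar>f s\<bar>
        + \<bar>f y\<bar> / \<eta>\<^sup>2 * (normal_density y \<sigma> s * (s - y)\<^sup>2)))"
    have wi: "integrable lborel w"
      unfolding w_def using f m2i by (intro Bochner_Integration.integrable_add integrable_mult_right) auto
    have pt: "norm (f s * normal_density y \<sigma> s - f y * normal_density y \<sigma> s) \<le> w s" for s
    proof (cases "\<bar>s - y\<bar> < \<eta>")
      case True
      have "norm (f s * normal_density y \<sigma> s - f y * normal_density y \<sigma> s) = \<bar>f s - f y\<bar> * normal_density y \<sigma> s"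
        by (simp add: abs_mult flip: left_diff_distrib)
      also have "\<dots> \<le> e / 2 * normal_density y \<sigma> s"
        using \<eta>(2)[OF True] by (intro mult_right_mono) auto
      also have "\<dots> \<le> w s" unfolding w_def using \<sigma> \<eta>(1) by simp
      finally show ?thesis .
    next
      case False
      have sq: "\<eta>\<^sup>2 \<le> (s - y)\<^sup>2" using False \<eta>(1) power_mono[of \<eta> "\<bar>s - y\<bar>" 2] by auto
      have "norm (f s * normal_density y \<sigma> s - f y * normal_density y \<sigma> s)
          \<le> \<bar>f s\<bar> * normal_density y \<sigma> s + \<bar>f y\<bar> * normal_density y \<sigma> s"
        using norm_triangle_ineq4[of "f s * normal_density y \<sigma> s" "f y * normal_density y \<sigma> s"] by (simp add: abs_mult)
      also have "\<bar>f s\<bar> * normal_density y \<sigma> s \<le> \<bar>f s\<bar> * (2 * \<sigma> / \<eta>\<^sup>2)"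
        using normal_density_tail_le[OF \<sigma> \<eta>(1), of s y] False by (intro mult_left_mono) auto
      also have "\<bar>f y\<bar> * normal_density y \<sigma> s \<le> \<bar>f y\<bar> / \<eta>\<^sup>2 * (normal_density y \<sigma> s * (s - y)\<^sup>2)"
      proof -
        have "\<bar>f y\<bar> * normal_density y \<sigma> s * \<eta>\<^sup>2 \<le> \<bar>f y\<bar> * normal_density y \<sigma> s * (s - y)\<^sup>2"
          using sq by (intro mult_left_mono) auto
        then show ?thesis using \<eta>(1) by (simp add: field_simps)
      qed
      also have "\<bar>f s\<bar> * (2 * \<sigma> / \<eta>\<^sup>2) + \<bar>f y\<bar> / \<eta>\<^sup>2 * (normal_density y \<sigma> s * (s - y)\<^sup>2) \<le> w s"
        unfolding w_def using e by (simp add: mult.commute)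
      finally show ?thesis by simp
    qed
    have di: "integrable lborel (\<lambda>s. f s * normal_density y \<sigma> s - f y * normal_density y \<sigma> s)"
      using bi by simp
    have "(LINT s|lborel. f s * normal_density y \<sigma> s - f y * normal_density y \<sigma> s)
        = (LINT s|lborel. f s * normal_density y \<sigma> s) - f y"
      using bi \<sigma> by simp
    moreover have "\<bar>LINT s|lborel. f s * normal_density y \<sigma> s - f y * normal_density y \<sigma> s\<bar> \<le> integral\<^sup>L lborel w"
      using Bochner_Integration.integral_norm_bound_integral[OF di wi] pt by simp
    moreover have "integral\<^sup>L lborel w = e / 2 + (2 * \<sigma> / \<eta>\<^sup>2 * A + \<bar>f y\<bar> / \<eta>\<^sup>2 * \<sigma>\<^sup>2)"
      unfolding w_def A_def using f m2i \<sigma> by (simp add: m2)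
    ultimately show ?thesis by simp
  qed
  have "((\<lambda>\<sigma>. 2 * \<sigma> / \<eta>\<^sup>2 * A + \<bar>f y\<bar> / \<eta>\<^sup>2 * \<sigma>\<^sup>2) \<longlongrightarrow> 0) (at_right 0)"
    using \<eta>(1) by (auto intro!: tendsto_eq_intros)
  then have "\<forall>\<^sub>F \<sigma> in at_right 0. 2 * \<sigma> / \<eta>\<^sup>2 * A + \<bar>f y\<bar> / \<eta>\<^sup>2 * \<sigma>\<^sup>2 < e / 2"
    using e by (intro order_tendstoD) auto
  then show "\<forall>\<^sub>F \<sigma> in at_right 0. dist (LINT s|lborel. f s * normal_density y \<sigma> s) (f y) < e"
    using eventually_at_right_less[of 0]
  proof eventually_elim
    case (elim \<sigma>)
    then show ?case using bound[of \<sigma>] unfolding dist_real_def by linarith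
  qed
qed

subsection \<open>Exponential decay of the density\<close>

text \<open>Contour shift expressed through a primitive \<open>P\<close> on the convex strip: the
  integral over a segment of the real axis is an increment of \<open>P\<close>, compared with the
  increment at height \<open>\<beta>\<close>. The function \<open>e\<close> controls the vertical
  sides and the boundary terms; only its limit matters, so it does not enter the final bound. There
  \<open>exp (- \<beta> * y)\<close> is the modulus of \<open>exp (i y w)\<close> at height
  \<open>\<beta>\<close>, and \<open>pi\<close> is the integral of
  \<open>1 / (1 + x\<^sup>2)\<close>.\<close>

lemma shifted_line_bound:
  fixes h :: "complex \<Rightarrow> complex" and lo hi \<beta> y C T0 :: real and e :: "real \<Rightarrow> real"
  defines "U \<equiv> {w. lo < Im w \<and> Im w < hi}"
  assumes lohi: "lo < 0" "0 < hi" and \<beta>: "lo < \<beta>" "\<beta> < hi"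
    and hol: "h holomorphic_on U"
    and h2: "\<And>x. norm (deriv (deriv h) (Complex x \<beta>)) \<le> C / (1 + x\<^sup>2)"
    and small: "\<And>x v. \<bar>x\<bar> \<ge> T0 \<Longrightarrow> v \<in> closed_segment 0 \<beta> \<Longrightarrow> norm (h (Complex x v)) \<le> e \<bar>x\<bar>"
    and small': "\<And>x. \<bar>x\<bar> \<ge> T0 \<Longrightarrow> norm (deriv h (Complex x \<beta>)) \<le> e \<bar>x\<bar>"
    and e: "(e \<longlongrightarrow> 0) at_top"
    and y: "y \<noteq> 0"
    and int: "integrable lborel (\<lambda>x. h (complex_of_real x) * cis (y * x))"
  shows "norm (LINT x|lborel. h (complex_of_real x) * cis (y * x)) \<le> C * pi * exp (- \<beta> * y) / y\<^sup>2"
proof -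
  have opU: "open U" unfolding U_def
    by (intro open_Collect_conj open_Collect_less continuous_intros)
  have cvU: "convex U"
  proof -
    have "U = {w. Im w > lo} \<inter> {w. Im w < hi}" unfolding U_def by auto
    then show ?thesis by (simp add: convex_Int convex_halfspace_Im_gt convex_halfspace_Im_lt)
  qed
  have inU: "Complex x v \<in> U" if "v \<in> closed_segment 0 \<beta>" for x v
    using that lohi \<beta> unfolding U_def by (auto simp: closed_segment_eq_real_ivl split: if_splits)
  have segs: "0 \<in> closed_segment 0 \<beta>" "\<beta> \<in> closed_segment 0 \<beta>" by auto
  define ex where "ex = (\<lambda>w. exp (\<i> * of_real y * w))"
  define k where "k = (\<lambda>w. h w * ex w)"
  define iy where "iy = \<i> * complex_of_real y"
  have iy: "iy \<noteq> 0" "norm iy = \<bar>y\<bar>" unfolding iy_def using y by (auto simp: norm_mult)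
  have hol1: "deriv h holomorphic_on U" using hol opU by (rule holomorphic_deriv)
  have dh: "(h has_field_derivative deriv h w) (at w)" if "w \<in> U" for w
    using holomorphic_derivI[OF hol opU that] .
  have dh1: "(deriv h has_field_derivative deriv (deriv h) w) (at w)" if "w \<in> U" for w
    using holomorphic_derivI[OF hol1 opU that] .
  have dex: "(ex has_field_derivative iy * ex w) (at w)" for w
    unfolding ex_def iy_def by (auto intro!: derivative_eq_intros)
  have nex: "norm (ex w) = exp (- y * Im w)" for w
    unfolding ex_def by (simp add: norm_exp_eq_Re)
  have "k holomorphic_on U" unfolding k_def ex_def by (intro holomorphic_intros hol)
  then obtain P where "\<And>w. w \<in> U \<Longrightarrow> (P has_field_derivative k w) (at w within U)"
    using holomorphic_convex_primitive'[OF cvU opU] by blast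
  then have P: "(P has_field_derivative k w) (at w)" if "w \<in> U" for w
    using that opU by (metis at_within_open)
  \<comment> \<open>\<open>Q\<close> is what two integrations by parts of
    \<open>h w * exp (i y w)\<close> leave outside the integral. Since
    \<open>(i y)\<^sup>2 = - y\<^sup>2\<close>, its derivative is the integrand plus a term with the
    second derivative of \<open>h\<close>, so \<open>P - Q\<close> sees only that term.\<close>
  define Q where "Q = (\<lambda>w. h w * ex w / iy - deriv h w * ex w / iy\<^sup>2)"
  have Q: "(Q has_field_derivative (k w + deriv (deriv h) w * ex w / (of_real y)\<^sup>2)) (at w)" if "w \<in> U" for w
  proof -
    have "(Q has_field_derivative ((deriv h w * ex w + h w * (iy * ex w)) / iy
        - (deriv (deriv h) w * ex w + deriv h w * (iy * ex w)) / iy\<^sup>2)) (at w)"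
      unfolding Q_def
      using DERIV_diff[OF DERIV_cdivide[OF DERIV_mult[OF dh[OF that] dex], of iy]
          DERIV_cdivide[OF DERIV_mult[OF dh1[OF that] dex], of "iy\<^sup>2"]]
      by (simp add: mult.commute)
    also have "(deriv h w * ex w + h w * (iy * ex w)) / iy - (deriv (deriv h) w * ex w + deriv h w * (iy * ex w)) / iy\<^sup>2
        = k w - deriv (deriv h) w * ex w / iy\<^sup>2"
      using iy(1) unfolding k_def by (simp add: field_simps power2_eq_square)
    also have "iy\<^sup>2 = - (of_real y)\<^sup>2" unfolding iy_def by (simp add: power_mult_distrib)
    finally show ?thesis by simp
  qed
  define R where "R = (\<lambda>w. P w - Q w)"
  have R: "(R has_field_derivative - (deriv (deriv h) w * ex w / (of_real y)\<^sup>2)) (at w)" if "w \<in> U" for w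
    unfolding R_def using DERIV_diff[OF P[OF that] Q[OF that]] by simp
  define D where "D = C * exp (- \<beta> * y) / y\<^sup>2"
  have hz: "((\<lambda>x. Complex x v) has_vector_derivative 1) (at x)" for x v
    unfolding Complex_eq by (auto intro!: derivative_eq_intros has_vector_derivative_of_real)
  have Rvd: "((\<lambda>x. R (Complex x \<beta>)) has_vector_derivative - (deriv (deriv h) (Complex x \<beta>) * ex (Complex x \<beta>) / (of_real y)\<^sup>2)) (at x)" for x
    using field_vector_diff_chain_at[OF hz R[OF inU[OF segs(2)]]] by (simp add: o_def)
  have Pvd: "((\<lambda>x. P (complex_of_real x)) has_vector_derivative k (complex_of_real x)) (at x)" for x
    using field_vector_diff_chain_at[OF hz P[OF inU[OF segs(1)]]] by (simp add: o_def complex_of_real_def)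
  \<comment> \<open>The increment of \<open>P\<close> along the line of height \<open>\<beta>\<close> after two integrations by parts: \<open>Q\<close> collects
    the boundary terms, and \<open>R\<close> is controlled by a multiple of the arctangent.\<close>
  have Rb: "norm (R (Complex T \<beta>) - R (Complex (- T) \<beta>)) \<le> D * pi" if T: "T > 0" for T
  proof -
    have "norm (R (Complex T \<beta>) - R (Complex (- T) \<beta>)) \<le> D * arctan T - D * arctan (- T)"
    proof (rule differentiable_bound_general[where \<phi>="\<lambda>x. D * arctan x" and \<phi>'="\<lambda>x. D / (1 + x\<^sup>2)"])
      show "- T < T" using T by simp
      show "continuous_on {- T..T} (\<lambda>x. R (Complex x \<beta>))"
        using Rvd has_vector_derivative_continuous by (intro continuous_at_imp_continuous_on) blast
      show "continuous_on {- T..T} (\<lambda>x. D * arctan x)" by (intro continuous_intros)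
      show "((\<lambda>x. R (Complex x \<beta>)) has_vector_derivative - (deriv (deriv h) (Complex x \<beta>) * ex (Complex x \<beta>) / (of_real y)\<^sup>2)) (at x)" for x
        by (rule Rvd)
      show "((\<lambda>x. D * arctan x) has_vector_derivative D / (1 + x\<^sup>2)) (at x)" for x
        by (auto intro!: derivative_eq_intros simp flip: has_real_derivative_iff_has_vector_derivative simp: divide_inverse)
      show "norm (- (deriv (deriv h) (Complex x \<beta>) * ex (Complex x \<beta>) / (of_real y)\<^sup>2)) \<le> D / (1 + x\<^sup>2)" for x
      proof -
        have "norm (deriv (deriv h) (Complex x \<beta>)) * exp (- \<beta> * y) / y\<^sup>2 \<le> C / (1 + x\<^sup>2) * exp (- \<beta> * y) / y\<^sup>2"
          by (intro divide_right_mono mult_right_mono h2) auto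
        then show ?thesis by (simp add: norm_mult norm_divide norm_power nex D_def mult.commute)
      qed
    qed
    also have "\<dots> = D * (2 * arctan T)" by (simp add: arctan_minus)
    also have "\<dots> \<le> D * pi"
    proof (rule mult_left_mono)
      show "2 * arctan T \<le> pi" using arctan_ubound[of T] by simp
      have "0 \<le> C / (1 + 0\<^sup>2)" using order_trans[OF norm_ge_zero h2[of 0]] .
      then show "0 \<le> D" unfolding D_def by simp
    qed
    finally show ?thesis .
  qed
  define M where "M = exp (\<bar>y\<bar> * \<bar>\<beta>\<bar>)"
  have nexM: "norm (ex (Complex x v)) \<le> M" if "v \<in> closed_segment 0 \<beta>" for x v
  proof -
    have "\<bar>v\<bar> \<le> \<bar>\<beta>\<bar>" using that by (auto simp: closed_segment_eq_real_ivl split: if_splits)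
    then have "- y * v \<le> \<bar>y\<bar> * \<bar>\<beta>\<bar>"
      by (metis abs_ge_self abs_ge_zero abs_minus_cancel abs_mult mult_left_mono order_trans)
    then show ?thesis unfolding nex M_def by simp
  qed
  have M0: "M \<ge> 0" unfolding M_def by simp
  have Qb: "norm (Q (Complex x \<beta>)) \<le> e \<bar>x\<bar> * M * (1 / \<bar>y\<bar> + 1 / y\<^sup>2)" if x: "\<bar>x\<bar> \<ge> T0" for x
  proof -
    have e0: "0 \<le> e \<bar>x\<bar>" using order_trans[OF norm_ge_zero small'[OF x]] .
    have "norm (Q (Complex x \<beta>)) \<le> norm (h (Complex x \<beta>)) * norm (ex (Complex x \<beta>)) / \<bar>y\<bar>
        + norm (deriv h (Complex x \<beta>)) * norm (ex (Complex x \<beta>)) / y\<^sup>2"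
      unfolding Q_def by (rule order_trans[OF norm_triangle_ineq4]) (simp add: norm_mult norm_divide norm_power iy)
    also have "\<dots> \<le> e \<bar>x\<bar> * M / \<bar>y\<bar> + e \<bar>x\<bar> * M / y\<^sup>2"
      using small[OF x segs(2)] small'[OF x] nexM[OF segs(2)] e0 M0
      by (intro add_mono divide_right_mono mult_mono) auto
    finally show ?thesis by (simp add: algebra_simps)
  qed
  \<comment> \<open>The vertical sides of the rectangle: mean value inequality for \<open>P\<close>
    on a segment of length \<open>|\<beta>|\<close>, where the integrand is at most
    \<open>e |x| * M\<close>.\<close>
  have Pb: "norm (P (Complex x \<beta>) - P (Complex x 0)) \<le> e \<bar>x\<bar> * M * \<bar>\<beta>\<bar>" if x: "\<bar>x\<bar> \<ge> T0" for x
  proof -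
    let ?S = "Complex x ` closed_segment 0 \<beta>"
    have S: "?S = closed_segment (Complex x 0) (Complex x \<beta>)"
      unfolding closed_segment_def
      by (intro set_eqI) (auto simp: image_iff complex_eq_iff algebra_simps)
    have "norm (P (Complex x \<beta>) - P (Complex x 0)) \<le> e \<bar>x\<bar> * M * norm (Complex x \<beta> - Complex x 0)"
    proof (rule field_differentiable_bound[where S="?S" and f'=k])
      show "convex ?S" unfolding S by simp
      show "(P has_field_derivative k z) (at z within ?S)" if "z \<in> ?S" for z
        using that by (auto intro!: has_field_derivative_at_within[OF P] inU)
      show "norm (k z) \<le> e \<bar>x\<bar> * M" if z: "z \<in> ?S" for z
      proof -
        from z obtain v where v: "z = Complex x v" "v \<in> closed_segment 0 \<beta>" by auto
        have "0 \<le> e \<bar>x\<bar>" using order_trans[OF norm_ge_zero small'[OF x]] .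
        then show ?thesis unfolding k_def norm_mult v(1)
          using small[OF x v(2)] nexM[OF v(2), of x] M0 by (intro mult_mono) auto
      qed
    qed (use segs in auto)
    moreover have "norm (Complex x \<beta> - Complex x 0) = \<bar>\<beta>\<bar>" by (simp add: cmod_def)
    ultimately show ?thesis by simp
  qed
  define J where "J = (\<lambda>n::nat. P (of_real (real n)) - P (of_real (- real n)))"
  define M' where "M' = 2 * (M * (1 / \<bar>y\<bar> + 1 / y\<^sup>2) + M * \<bar>\<beta>\<bar>)"
  have Jb: "norm (J n) \<le> D * pi + e (real n) * M'" if n: "real n \<ge> T0" "n > 0" for n
  proof -
    define T where "T = real n"
    have T: "\<bar>T\<bar> \<ge> T0" "\<bar>- T\<bar> \<ge> T0" "T > 0" using n unfolding T_def by auto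
    \<comment> \<open>The rectangle is closed by telescoping: \<open>P = R + Q\<close> along the
      side at height \<open>\<beta>\<close>, and the last two brackets are the vertical
      sides.\<close>
    have "J n = (R (Complex T \<beta>) - R (Complex (- T) \<beta>)) + Q (Complex T \<beta>) - Q (Complex (- T) \<beta>)
        - (P (Complex T \<beta>) - P (Complex T 0)) + (P (Complex (- T) \<beta>) - P (Complex (- T) 0))"
      unfolding J_def R_def T_def complex_of_real_def by simp
    also have "norm \<dots> \<le> norm (R (Complex T \<beta>) - R (Complex (- T) \<beta>)) + norm (Q (Complex T \<beta>)) + norm (Q (Complex (- T) \<beta>))
        + norm (P (Complex T \<beta>) - P (Complex T 0)) + norm (P (Complex (- T) \<beta>) - P (Complex (- T) 0))"
      by (intro norm_add_rule_thm norm_triangle_le norm_triangle_le_diff add_mono order_refl)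
    also have "\<dots> \<le> D * pi + e T * M * (1 / \<bar>y\<bar> + 1 / y\<^sup>2) + e T * M * (1 / \<bar>y\<bar> + 1 / y\<^sup>2) + e T * M * \<bar>\<beta>\<bar> + e T * M * \<bar>\<beta>\<bar>"
      using Rb[OF T(3)] Qb[OF T(1)] Qb[OF T(2)] Pb[OF T(1)] Pb[OF T(2)] T(3) by (intro add_mono) auto
    also have "\<dots> = D * pi + e (real n) * M'" unfolding M'_def T_def by (simp add: algebra_simps)
    finally show ?thesis .
  qed
  define I where "I = (LINT x|lborel. h (complex_of_real x) * cis (y * x))"
  have kx: "k (complex_of_real x) = h (complex_of_real x) * cis (y * x)" for x
    unfolding k_def ex_def by (simp add: cis_conv_exp mult.assoc)
  have Jeq: "J n = (LINT x|lborel. indicator {- real n..real n} x *\<^sub>R k (complex_of_real x))" for n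
  proof -
    have "continuous_on {- real n..real n} (\<lambda>x. k (complex_of_real x))"
    proof (rule continuous_on_compose2[of U k])
      show "continuous_on U k" using \<open>k holomorphic_on U\<close> by (rule holomorphic_on_imp_continuous_on)
      show "complex_of_real ` {- real n..real n} \<subseteq> U" unfolding U_def using lohi by auto
    qed (intro continuous_intros)
    then show ?thesis unfolding J_def
      by (intro integral_FTC_atLeastAtMost[symmetric] has_vector_derivative_at_within[OF Pvd]) auto
  qed
  have "J \<longlonglongrightarrow> I"
    unfolding Jeq I_def kx
  proof (rule integral_dominated_convergence[where w="\<lambda>x. norm (h (complex_of_real x) * cis (y * x))"])
    have m[measurable]: "(\<lambda>x. h (complex_of_real x) * cis (y * x)) \<in> borel_measurable lborel"
      using int by (rule borel_measurable_integrable)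
    show "(\<lambda>x. h (complex_of_real x) * cis (y * x)) \<in> borel_measurable lborel" by (rule m)
    show "(\<lambda>x. indicator {- real n..real n} x *\<^sub>R (h (complex_of_real x) * cis (y * x))) \<in> borel_measurable lborel" for n
      by (intro borel_measurable_scaleR m) auto
    show "integrable lborel (\<lambda>x. norm (h (complex_of_real x) * cis (y * x)))" using int by (rule integrable_norm)
    show "AE x in lborel. (\<lambda>n. indicator {- real n..real n} x *\<^sub>R (h (complex_of_real x) * cis (y * x)))
        \<longlonglongrightarrow> h (complex_of_real x) * cis (y * x)"
    proof (intro AE_I2 tendsto_eventually)
      fix x :: real
      show "\<forall>\<^sub>F n in sequentially. indicator {- real n..real n} x *\<^sub>R (h (complex_of_real x) * cis (y * x)) = h (complex_of_real x) * cis (y * x)"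
        using eventually_ge_at_top[of "nat \<lceil>\<bar>x\<bar>\<rceil>"]
      proof eventually_elim
        case (elim n)
        then have "\<bar>x\<bar> \<le> real n" by linarith
        then show ?case by (auto simp: indicator_def abs_le_iff)
      qed
    qed
    show "AE x in lborel. norm (indicator {- real n..real n} x *\<^sub>R (h (complex_of_real x) * cis (y * x))) \<le> norm (h (complex_of_real x) * cis (y * x))" for n
      by (auto simp: indicator_def)
  qed
  then have lim1: "(\<lambda>n. norm (J n)) \<longlonglongrightarrow> norm I" by (rule tendsto_norm)
  have "(\<lambda>n. e (real n)) \<longlonglongrightarrow> 0"
    by (rule filterlim_compose[OF e filterlim_real_sequentially])
  then have lim2: "(\<lambda>n. D * pi + e (real n) * M') \<longlonglongrightarrow> D * pi"
    by (auto intro!: tendsto_eq_intros)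
  have "norm I \<le> D * pi"
  proof (rule tendsto_le[OF _ lim2 lim1])
    show "\<forall>\<^sub>F n in sequentially. norm (J n) \<le> D * pi + e (real n) * M'"
      using eventually_ge_at_top[of "nat \<lceil>T0\<rceil>"] eventually_gt_at_top[of 0]
    proof eventually_elim
      case (elim n)
      then show ?case by (intro Jb) linarith+
    qed
  qed simp
  then show ?thesis unfolding I_def D_def by (simp add: mult_ac)
qed

text \<open>\<open>S\<close> is a double sector around the two ends of the real axis. Far out on the
  line of height \<open>\<beta>\<close>, Cauchy's inequality is applied on discs inside
  \<open>S\<close> whose radius grows with \<open>|x|\<close>; on the middle part, discs of fixed
  radius inside the strip and compactness suffice. The value \<open>f y\<close> is reached as a
  limit of mollifications, hence the restriction to points of continuity.\<close>

lemma tilted_density_decay: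
  fixes f :: "real \<Rightarrow> real" and F :: "complex \<Rightarrow> complex" and lo hi \<beta> \<kappa> R0 B :: real
  defines "U \<equiv> {w. lo < Im w \<and> Im w < hi}" and "S \<equiv> {w. \<bar>Im w\<bar> < \<kappa> * (\<bar>Re w\<bar> - R0)}"
  assumes f: "integrable lborel f"
    and F: "\<And>x::real. F (complex_of_real x) = fourier f (complex_of_real x)"
    and lohi: "lo < 0" "0 < hi" and \<beta>: "lo < \<beta>" "\<beta> < hi"
    and \<kappa>: "0 < \<kappa>" "\<kappa> \<le> 1" and R0: "R0 \<ge> 0"
    and holU: "F holomorphic_on U" and holS: "F holomorphic_on S"
    and FB: "\<And>w. w \<in> S \<Longrightarrow> norm (F w) \<le> B"
  shows "\<exists>C. \<forall>y. y \<noteq> 0 \<longrightarrow> isCont f y \<longrightarrow> \<bar>f y\<bar> \<le> C * exp (- \<beta> * y) / y\<^sup>2"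
proof -
  have opU: "open U" unfolding U_def
    by (intro open_Collect_conj open_Collect_less continuous_intros)
  have opS: "open S" unfolding S_def
    by (intro open_Collect_less continuous_intros)
  define V where "V = U \<union> S"
  have holV: "F holomorphic_on V"
    unfolding V_def using opU opS holU holS by (auto intro: holomorphic_on_Un)
  \<comment> \<open>For \<open>|x| \<ge> R1\<close>, discs of radius
    \<open>\<kappa> * |x| / 4\<close> about points \<open>x + i v\<close> with
    \<open>|v| \<le> |\<beta>|\<close> fit into \<open>S\<close>. There
    \<open>|Im w| \<le> |\<beta>| + \<kappa> * |x| / 4\<close> and
    \<open>|Re w| \<ge> 3/4 * |x|\<close>, so
    \<open>\<kappa> * |x| / 2 > |\<beta>| + \<kappa> * R0\<close> is enough; the \<open>+ 1\<close>
    makes this strict and gives \<open>R1 \<ge> 1\<close>.\<close>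
  define R1 where "R1 = 2 * (\<bar>\<beta>\<bar> / \<kappa> + R0) + 1"
  have R1: "R1 \<ge> 1" unfolding R1_def using R0 \<kappa> by simp
  have inS: "w \<in> S" if x: "\<bar>x\<bar> \<ge> R1" and w: "norm (w - Complex x v) \<le> \<kappa> * \<bar>x\<bar> / 4" and v: "\<bar>v\<bar> \<le> \<bar>\<beta>\<bar>" for w x v
  proof -
    have 1: "\<bar>Im w - v\<bar> \<le> \<kappa> * \<bar>x\<bar> / 4" "\<bar>Re w - x\<bar> \<le> \<kappa> * \<bar>x\<bar> / 4"
      using abs_Im_le_cmod[of "w - Complex x v"] abs_Re_le_cmod[of "w - Complex x v"] w by auto
    have "\<kappa> * \<bar>x\<bar> \<le> 1 * \<bar>x\<bar>" using \<kappa> by (intro mult_right_mono) auto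
    then have 2: "\<bar>Re w\<bar> \<ge> 3 / 4 * \<bar>x\<bar>" using 1(2) by linarith
    have arith: "i < \<kappa> * (W - R0)"
      if "X \<ge> 2 * (c / \<kappa> + R0) + 1" "3 / 4 * X \<le> W" "i \<le> c + \<kappa> * X / 4" for X W c i :: real
    proof -
      have "\<kappa> * (3 / 4 * X) \<le> \<kappa> * W" using that(2) \<kappa> by (intro mult_left_mono) auto
      moreover have "\<kappa> * (2 * (c / \<kappa> + R0) + 1) \<le> \<kappa> * X" using that(1) \<kappa> by (intro mult_left_mono) auto
      moreover have "\<kappa> * (2 * (c / \<kappa> + R0) + 1) = 2 * c + 2 * (\<kappa> * R0) + \<kappa>"
        using \<kappa> by (simp add: field_simps)
      moreover have "\<kappa> * (3 / 4 * X) = 3 / 4 * (\<kappa> * X)" "\<kappa> * (W - R0) = \<kappa> * W - \<kappa> * R0" by (simp_all add: algebra_simps)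
      ultimately show ?thesis using that(3) \<kappa> by linarith
    qed
    have "\<bar>Im w\<bar> \<le> \<bar>\<beta>\<bar> + \<kappa> * \<bar>x\<bar> / 4" using 1(1) v by linarith
    from arith[OF x[unfolded R1_def] 2 this] show ?thesis unfolding S_def by simp
  qed
  have B0: "B \<ge> 0"
  proof -
    have "Complex R1 0 \<in> S" by (rule inS[of R1 _ 0]) (use R1 \<kappa> in auto)
    then show ?thesis using FB[of "Complex R1 0"] norm_ge_zero[of "F (Complex R1 0)"] by linarith
  qed
  obtain \<rho> where \<rho>: "\<rho> > 0" "lo < \<beta> - \<rho>" "\<beta> + \<rho> < hi"
  proof
    show "min (\<beta> - lo) (hi - \<beta>) / 2 > 0" "lo < \<beta> - min (\<beta> - lo) (hi - \<beta>) / 2" "\<beta> + min (\<beta> - lo) (hi - \<beta>) / 2 < hi"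
      using \<beta> by (auto simp: min_def field_simps)
  qed
  \<comment> \<open>A compact rectangle in the strip that contains every disc of radius
    \<open>\<rho>\<close> centred at \<open>x + i \<beta>\<close> with
    \<open>|x| \<le> R1\<close>.\<close>
  define K where "K = cbox (Complex (- R1 - \<rho>) (\<beta> - \<rho>)) (Complex (R1 + \<rho>) (\<beta> + \<rho>))"
  have KU: "K \<subseteq> U" unfolding K_def U_def using \<rho> by (auto simp: in_cbox_complex_iff)
  have "compact (F ` K)"
    using holomorphic_on_imp_continuous_on[OF holomorphic_on_subset[OF holU KU]]
    by (intro compact_continuous_image) (auto simp: K_def)
  then obtain B1 where B1: "\<And>w. w \<in> K \<Longrightarrow> norm (F w) \<le> B1" and B10: "B1 > 0"
    using compact_imp_bounded bounded_pos by (metis imageI)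
  \<comment> \<open>On \<open>K\<close> the Gaussian factor can exceed 1; its modulus is at most
    \<open>exp ((Im w)\<^sup>2 / 2)\<close> whenever \<open>\<sigma> \<le> 1\<close>, so
    \<open>E\<close> bounds it for all these \<open>\<sigma>\<close> at once.\<close>
  define E where "E = exp ((\<bar>\<beta>\<bar> + \<rho>)\<^sup>2)"
  \<comment> \<open>The first summand covers \<open>|x| \<le> R1\<close>, with
    \<open>1 + x\<^sup>2 \<le> 1 + R1\<^sup>2\<close>. In the second,
    \<open>2! * 4\<^sup>2 = 32\<close> comes from the Cauchy estimate with radius
    \<open>\<kappa> * |x| / 4\<close>, doubled by
    \<open>x\<^sup>2 \<ge> (1 + x\<^sup>2) / 2\<close>.\<close>
  define C where "C = 2 * (B1 * E) / \<rho>\<^sup>2 * (1 + R1\<^sup>2) + 64 * B / \<kappa>\<^sup>2"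
  \<comment> \<open>The bound \<open>C * pi\<close> on the inversion integral, divided by its factor
    \<open>2 * pi\<close>, leaves \<open>C / 2\<close>.\<close>
  have main: "\<bar>LINT s|lborel. f s * normal_density y \<sigma> s\<bar> \<le> C / 2 * exp (- \<beta> * y) / y\<^sup>2"
    if y: "y \<noteq> 0" and \<sigma>: "0 < \<sigma>" "\<sigma> \<le> 1" for y \<sigma>
  proof -
    \<comment> \<open>The entire extension of the Gaussian weight; on the real axis \<open>h\<close>
      is the integrand of the regularised inversion formula.\<close>
    define G where "G = (\<lambda>w::complex. exp (- (of_real \<sigma> * w)\<^sup>2 / 2))"
    define h where "h = (\<lambda>w. F w * G w)"
    have nG: "norm (G w) = exp (- (\<sigma>\<^sup>2 * ((Re w)\<^sup>2 - (Im w)\<^sup>2) / 2))" for w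
      unfolding G_def by (simp add: norm_exp_eq_Re power_mult_distrib Re_power2 flip: of_real_power)
    have holh: "h holomorphic_on V" unfolding h_def G_def by (intro holomorphic_intros holV) auto
    have \<sigma>2: "\<sigma>\<^sup>2 \<le> 1" using \<sigma> by (simp add: power_le_one)
    have hS: "norm (h w) \<le> B" if w: "w \<in> S" for w
    proof -
      have "0 < \<kappa> * (\<bar>Re w\<bar> - R0)" using w abs_ge_zero[of "Im w"] unfolding S_def by simp
      then have "0 < \<bar>Re w\<bar> - R0" using \<kappa> by (simp add: zero_less_mult_iff)
      then have "\<kappa> * (\<bar>Re w\<bar> - R0) \<le> 1 * (\<bar>Re w\<bar> - R0)" using \<kappa> by (intro mult_right_mono) auto
      then have "\<bar>Im w\<bar> \<le> \<bar>Re w\<bar>" using w R0 unfolding S_def by auto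
      then have "(Im w)\<^sup>2 \<le> (Re w)\<^sup>2" by (rule abs_le_square_iff[THEN iffD1])
      then have "norm (G w) \<le> 1" unfolding nG by simp
      then show ?thesis unfolding h_def norm_mult using FB[OF w] B0 mult_mono[of "norm (F w)" B "norm (G w)" 1] by simp
    qed
    have hK: "norm (h w) \<le> B1 * E" if w: "w \<in> K" for w
    proof -
      have "\<bar>Im w\<bar> \<le> \<bar>\<beta>\<bar> + \<rho>" using w unfolding K_def in_cbox_complex_iff by auto
      then have im: "(Im w)\<^sup>2 \<le> (\<bar>\<beta>\<bar> + \<rho>)\<^sup>2" using power_mono[of "\<bar>Im w\<bar>" "\<bar>\<beta>\<bar> + \<rho>" 2] by simp
      have "- (\<sigma>\<^sup>2 * ((Re w)\<^sup>2 - (Im w)\<^sup>2) / 2) \<le> \<sigma>\<^sup>2 * (Im w)\<^sup>2 / 2" by (simp add: field_simps)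
      also have "\<dots> \<le> 1 * (Im w)\<^sup>2 / 2" using \<sigma>2 by (intro divide_right_mono mult_right_mono) auto
      also have "\<dots> \<le> (Im w)\<^sup>2" by simp
      finally have "norm (G w) \<le> E" unfolding nG E_def using im by (intro exp_le_cancel_iff[THEN iffD2]) simp
      then show ?thesis unfolding h_def norm_mult using B1[OF w] B10 by (intro mult_mono) auto
    qed
    have cauchy: "norm ((deriv ^^ n) h z) \<le> fact n * b / \<eta> ^ n"
      if "\<eta> > 0" "cball z \<eta> \<subseteq> V" "\<And>w. w \<in> cball z \<eta> \<Longrightarrow> norm (h w) \<le> b" for n z \<eta> b
    proof (rule Cauchy_inequality)
      show "h holomorphic_on ball z \<eta>" using holh that(2) ball_subset_cball by (blast intro: holomorphic_on_subset)
      show "continuous_on (cball z \<eta>) h"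
        using holomorphic_on_imp_continuous_on[OF holh] that(2) by (rule continuous_on_subset)
      show "norm (h x) \<le> b" if "norm (z - x) = \<eta>" for x
        using \<open>\<And>w. w \<in> cball z \<eta> \<Longrightarrow> norm (h w) \<le> b\<close>[of x] that by (simp add: dist_norm)
    qed (rule that)
    have far: "norm ((deriv ^^ n) h (Complex x \<beta>)) \<le> fact n * B / (\<kappa> * \<bar>x\<bar> / 4) ^ n" if x: "\<bar>x\<bar> \<ge> R1" for n x
    proof (rule cauchy)
      show "\<kappa> * \<bar>x\<bar> / 4 > 0" using \<kappa> x R1 by simp
      have "cball (Complex x \<beta>) (\<kappa> * \<bar>x\<bar> / 4) \<subseteq> S"
        using inS[OF x, of _ \<beta>] by (auto simp: dist_norm norm_minus_commute)
      then show "cball (Complex x \<beta>) (\<kappa> * \<bar>x\<bar> / 4) \<subseteq> V" "\<And>w. w \<in> cball (Complex x \<beta>) (\<kappa> * \<bar>x\<bar> / 4) \<Longrightarrow> norm (h w) \<le> B"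
        using hS unfolding V_def by auto
    qed
    have near: "norm ((deriv ^^ 2) h (Complex x \<beta>)) \<le> fact 2 * (B1 * E) / \<rho> ^ 2" if x: "\<bar>x\<bar> \<le> R1" for x
    proof (rule cauchy)
      have "cball (Complex x \<beta>) \<rho> \<subseteq> K"
      proof
        fix w assume "w \<in> cball (Complex x \<beta>) \<rho>"
        then have "norm (w - Complex x \<beta>) \<le> \<rho>" by (simp add: dist_norm norm_minus_commute)
        then have "\<bar>Im w - \<beta>\<bar> \<le> \<rho>" "\<bar>Re w - x\<bar> \<le> \<rho>"
          using abs_Im_le_cmod[of "w - Complex x \<beta>"] abs_Re_le_cmod[of "w - Complex x \<beta>"] by auto
        then show "w \<in> K" using x unfolding K_def in_cbox_complex_iff by auto
      qed
      then show "cball (Complex x \<beta>) \<rho> \<subseteq> V" "\<And>w. w \<in> cball (Complex x \<beta>) \<rho> \<Longrightarrow> norm (h w) \<le> B1 * E"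
        using hK KU unfolding V_def by auto
    qed (rule \<rho>)
    have E0: "E > 0" unfolding E_def by simp
    have h2: "norm (deriv (deriv h) (Complex x \<beta>)) \<le> C / (1 + x\<^sup>2)" for x
    proof (cases "\<bar>x\<bar> \<le> R1")
      case True
      have "norm (deriv (deriv h) (Complex x \<beta>)) \<le> 2 * (B1 * E) / \<rho>\<^sup>2"
        using near[OF True] by (simp add: numeral_2_eq_2)
      also have "\<dots> = 2 * (B1 * E) / \<rho>\<^sup>2 * (1 + x\<^sup>2) / (1 + x\<^sup>2)"
        using sum_power2_gt_zero_iff[of 1 x] by simp
      also have "\<dots> \<le> C / (1 + x\<^sup>2)"
      proof (rule divide_right_mono)
        have "x\<^sup>2 \<le> R1\<^sup>2" using True power_mono[of "\<bar>x\<bar>" R1 2] by simp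
        then have "2 * (B1 * E) / \<rho>\<^sup>2 * (1 + x\<^sup>2) \<le> 2 * (B1 * E) / \<rho>\<^sup>2 * (1 + R1\<^sup>2)"
          using B10 E0 by (intro mult_left_mono) auto
        also have "\<dots> \<le> C" unfolding C_def using B0 by simp
        finally show "2 * (B1 * E) / \<rho>\<^sup>2 * (1 + x\<^sup>2) \<le> C" .
      qed (auto intro: add_nonneg_nonneg)
      finally show ?thesis .
    next
      case False
      have x2: "x\<^sup>2 \<ge> 1" using False R1 power_mono[of 1 "\<bar>x\<bar>" 2] by simp
      have "norm (deriv (deriv h) (Complex x \<beta>)) \<le> fact 2 * B / (\<kappa> * \<bar>x\<bar> / 4) ^ 2"
        using far[of x 2] False by (simp add: numeral_2_eq_2)
      also have "\<dots> = 32 * B / \<kappa>\<^sup>2 / x\<^sup>2"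
        by (simp add: power_divide power_mult_distrib)
      also have "\<dots> \<le> 32 * B / \<kappa>\<^sup>2 / ((1 + x\<^sup>2) / 2)"
        using x2 B0 by (intro divide_left_mono) (auto intro!: mult_pos_pos add_pos_nonneg)
      also have "\<dots> = 64 * B / \<kappa>\<^sup>2 / (1 + x\<^sup>2)" by simp
      also have "\<dots> \<le> C / (1 + x\<^sup>2)"
        unfolding C_def using B10 E0 by (intro divide_right_mono) auto
      finally show ?thesis .
    qed
    \<comment> \<open>On the vertical sides \<open>F\<close> is merely bounded, so the decay of
      \<open>h\<close> comes from the Gaussian, at a rate depending on \<open>\<sigma>\<close>. The
      second summand is Cauchy's estimate for the first derivative.\<close>
    define e where "e = (\<lambda>T. B * exp (\<beta>\<^sup>2 - \<sigma>\<^sup>2 * T\<^sup>2 / 2) + 4 * B / (\<kappa> * T))"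
    have e: "(e \<longlongrightarrow> 0) at_top" unfolding e_def using \<sigma> \<kappa> by real_asymp
    have small: "norm (h (Complex x v)) \<le> e \<bar>x\<bar>" if x: "\<bar>x\<bar> \<ge> R1" and v: "v \<in> closed_segment 0 \<beta>" for x v
    proof -
      have v': "\<bar>v\<bar> \<le> \<bar>\<beta>\<bar>" using v by (auto simp: closed_segment_eq_real_ivl split: if_splits)
      then have vb: "v\<^sup>2 \<le> \<beta>\<^sup>2" by (rule abs_le_square_iff[THEN iffD1])
      have "Complex x v \<in> S" using inS[OF x, of "Complex x v" v] v' \<kappa> by simp
      then have FB': "norm (F (Complex x v)) \<le> B" by (rule FB)
      have "\<sigma>\<^sup>2 * v\<^sup>2 / 2 \<le> 1 * v\<^sup>2" using mult_right_mono[OF \<sigma>2, of "v\<^sup>2"] zero_le_power2[of v] by linarith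
      then have "- (\<sigma>\<^sup>2 * (x\<^sup>2 - v\<^sup>2) / 2) \<le> \<beta>\<^sup>2 - \<sigma>\<^sup>2 * \<bar>x\<bar>\<^sup>2 / 2"
        using vb by (simp add: algebra_simps diff_divide_distrib)
      then have "norm (G (Complex x v)) \<le> exp (\<beta>\<^sup>2 - \<sigma>\<^sup>2 * \<bar>x\<bar>\<^sup>2 / 2)" unfolding nG by simp
      then have "norm (h (Complex x v)) \<le> B * exp (\<beta>\<^sup>2 - \<sigma>\<^sup>2 * \<bar>x\<bar>\<^sup>2 / 2)"
        unfolding h_def norm_mult using FB' B0 by (intro mult_mono) auto
      also have "\<dots> \<le> e \<bar>x\<bar>" unfolding e_def using B0 \<kappa> by simp
      finally show ?thesis .
    qed
    have small': "norm (deriv h (Complex x \<beta>)) \<le> e \<bar>x\<bar>" if x: "\<bar>x\<bar> \<ge> R1" for x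
    proof -
      have "norm (deriv h (Complex x \<beta>)) \<le> 4 * B / (\<kappa> * \<bar>x\<bar>)"
        using far[OF x, of 1] by (simp add: mult.commute)
      also have "\<dots> \<le> e \<bar>x\<bar>" unfolding e_def using B0 by simp
      finally show ?thesis .
    qed
    have Gx: "G (complex_of_real x) = complex_of_real (exp (- (\<sigma> * x)\<^sup>2 / 2))" for x
      unfolding G_def by (simp flip: exp_of_real)
    have hx: "h (complex_of_real x) = fourier f (complex_of_real x) * complex_of_real (exp (- (\<sigma> * x)\<^sup>2 / 2))" for x
      unfolding h_def Gx F ..
    have "norm (LINT x|lborel. h (complex_of_real x) * cis (y * x)) \<le> C * pi * exp (- \<beta> * y) / y\<^sup>2"
    proof (rule shifted_line_bound[OF lohi \<beta> _ h2 small small' e y])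
      show "h holomorphic_on {w. lo < Im w \<and> Im w < hi}"
        using holh by (rule holomorphic_on_subset) (auto simp: V_def U_def)
      show "integrable lborel (\<lambda>x. h (complex_of_real x) * cis (y * x))"
        unfolding hx by (rule fourier_gaussian_inversion[OF f \<sigma>(1)])
    qed
    then have "\<bar>2 * pi * (LINT s|lborel. f s * normal_density y \<sigma> s)\<bar> \<le> C * pi * exp (- \<beta> * y) / y\<^sup>2"
      unfolding hx fourier_gaussian_inversion(2)[OF f \<sigma>(1)] norm_of_real .
    then have "(2 * pi) * \<bar>LINT s|lborel. f s * normal_density y \<sigma> s\<bar> \<le> (2 * pi) * (C / 2 * exp (- \<beta> * y) / y\<^sup>2)"
      by (simp add: abs_mult mult_ac)
    then show ?thesis by (rule mult_left_le_imp_le) simp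
  qed
  have "\<bar>f y\<bar> \<le> C / 2 * exp (- \<beta> * y) / y\<^sup>2" if y: "y \<noteq> 0" and cont: "isCont f y" for y
  proof (rule tendsto_upperbound[OF tendsto_rabs[OF gaussian_approximate_identity[OF f cont]]])
    show "\<forall>\<^sub>F \<sigma> in at_right 0. \<bar>LINT s|lborel. f s * normal_density y \<sigma> s\<bar> \<le> C / 2 * exp (- \<beta> * y) / y\<^sup>2"
    proof -
      have "\<forall>\<^sub>F \<sigma> in at_right (0::real). \<sigma> \<in> {0<..<1}" by (rule eventually_at_right_real) simp
      then show ?thesis by eventually_elim (rule main[OF y]; simp)
    qed
  qed simp
  then show ?thesis by blast
qed

section \<open>From pointwise decay to exponential and second moments\<close>

text \<open>Discontinuities can lie only on the frontiers of finitely many intervals, a null set: at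
  an interior point the derivative within the interval is an ordinary one.\<close>

lemma piecewise_C1_continuous_AE:
  assumes "piecewise (C1_on_interval f)"
  shows "AE x in lborel. isCont f x"
proof -
  from assms obtain \<I> where \<I>: "finite \<I>" "partition_on UNIV \<I>"
    and I: "\<And>I. I \<in> \<I> \<Longrightarrow> is_interval I" "\<And>I. I \<in> \<I> \<Longrightarrow> C1_on_interval f I"
    unfolding piecewise_def by blast
  define W where "W = (\<Union>I\<in>\<I>. frontier I)"
  have cont: "isCont f x" if x: "x \<notin> W" for x
  proof -
    obtain I where I': "I \<in> \<I>" "x \<in> I" using \<I>(2) unfolding partition_on_def by blast
    then have xi: "x \<in> interior I"
      using x closure_subset[of I] unfolding W_def frontier_def by auto
    from I(2)[OF I'(1)] have "\<exists>d. (f has_real_derivative d) (at x within I)"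
      using I'(2) unfolding C1_on_interval_def by blast
    then show ?thesis using at_within_interior[OF xi] DERIV_isCont by metis
  qed
  have "negligible W"
    unfolding W_def using \<I>(1) I(1) by (auto intro!: negligible_Union negligible_convex_frontier is_interval_convex)
  then have "W \<in> null_sets lebesgue" by (simp add: negligible_iff_null_sets)
  then have "AE x in lebesgue. x \<notin> W" by (rule AE_not_in)
  then have "AE x in lebesgue. isCont f x" by eventually_elim (rule cont)
  then show ?thesis by (simp add: AE_completion_iff)
qed

text \<open>The tilt cancels the exponential in the bound and leaves \<open>C / y\<^sup>2\<close>,
  which is integrable at infinity but not at 0. For \<open>|y| \<le> 1\<close> the weight is at most
  \<open>exp |\<beta>|\<close> and integrability of \<open>f\<close> takes over.\<close>

lemma integrable_exp_tilt:
  fixes f :: "real \<Rightarrow> real"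
  assumes f: "integrable lborel f" and cont: "AE y in lborel. isCont f y"
    and bnd: "\<And>y. y \<noteq> 0 \<Longrightarrow> isCont f y \<Longrightarrow> \<bar>f y\<bar> \<le> C * exp (- \<beta> * y) / y\<^sup>2"
  shows "integrable lborel (\<lambda>y. exp (\<beta> * y) * f y)"
proof (rule Bochner_Integration.integrable_bound)
  have [measurable]: "f \<in> borel_measurable borel" using f by auto
  show "(\<lambda>y. exp (\<beta> * y) * f y) \<in> borel_measurable lborel" by measurable
  have "integrable lborel (\<lambda>y::real. inverse (1 + y\<^sup>2))"
    using integrable_inverse_1_plus_square by (simp add: set_integrable_def)
  then show "integrable lborel (\<lambda>y. exp \<bar>\<beta>\<bar> * \<bar>f y\<bar> + 2 * \<bar>C\<bar> * inverse (1 + y\<^sup>2))"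
    using f by (intro Bochner_Integration.integrable_add integrable_mult_right integrable_abs)
  show "AE y in lborel. norm (exp (\<beta> * y) * f y) \<le> norm (exp \<bar>\<beta>\<bar> * \<bar>f y\<bar> + 2 * \<bar>C\<bar> * inverse (1 + y\<^sup>2))"
    using cont
  proof eventually_elim
    case (elim y)
    have pos: "inverse (1 + y\<^sup>2) > 0" by (simp add: add_pos_nonneg)
    have "exp (\<beta> * y) * \<bar>f y\<bar> \<le> exp \<bar>\<beta>\<bar> * \<bar>f y\<bar> + 2 * \<bar>C\<bar> * inverse (1 + y\<^sup>2)"
    proof (cases "\<bar>y\<bar> \<le> 1")
      case True
      have "\<beta> * y \<le> \<bar>\<beta>\<bar>"
        using mult_left_mono[OF True, of "\<bar>\<beta>\<bar>"] abs_ge_self[of "\<beta> * y"] by (simp add: abs_mult)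
      then have "exp (\<beta> * y) * \<bar>f y\<bar> \<le> exp \<bar>\<beta>\<bar> * \<bar>f y\<bar>" by (intro mult_right_mono) auto
      then show ?thesis using pos by (simp add: add_increasing2)
    next
      case False
      then have y: "y \<noteq> 0" and y2: "y\<^sup>2 \<ge> 1" using power_mono[of 1 "\<bar>y\<bar>" 2] by auto
      have "exp (\<beta> * y) * \<bar>f y\<bar> \<le> exp (\<beta> * y) * (C * exp (- \<beta> * y) / y\<^sup>2)"
        using bnd[OF y elim] by (intro mult_left_mono) auto
      also have "\<dots> = C / y\<^sup>2" by (simp add: exp_minus)
      also have "\<dots> \<le> \<bar>C\<bar> / y\<^sup>2" by (intro divide_right_mono) auto
      also have "\<dots> \<le> \<bar>C\<bar> / ((1 + y\<^sup>2) / 2)"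
        using y2 by (intro divide_left_mono) (auto intro!: mult_pos_pos add_pos_nonneg)
      also have "\<dots> = 2 * \<bar>C\<bar> * inverse (1 + y\<^sup>2)" by (simp add: inverse_eq_divide mult.commute)
      also have "\<dots> \<le> exp \<bar>\<beta>\<bar> * \<bar>f y\<bar> + \<dots>" by simp
      finally show ?thesis .
    qed
    then show ?case using pos by (simp add: abs_mult)
  qed
qed

text \<open>The strip is open, so there is room \<open>\<eta>\<close> on both sides of
  \<open>\<alpha>\<close>; the quadratic weight is absorbed by \<open>(\<eta> y)\<^sup>2 / 2 \<le>
  exp (\<eta> y) + exp (- \<eta> y)\<close>.\<close>

lemma integrable_square_exp_tilt:
  fixes f :: "real \<Rightarrow> real"
  assumes lohi: "lo < \<alpha>" "\<alpha> < hi"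
    and tilt: "\<And>\<beta>. lo < \<beta> \<Longrightarrow> \<beta> < hi \<Longrightarrow> integrable lborel (\<lambda>y. exp (\<beta> * y) * f y)"
  shows "integrable lborel (\<lambda>y. y\<^sup>2 * (exp (\<alpha> * y) * f y))"
proof (rule Bochner_Integration.integrable_bound)
  define \<eta> where "\<eta> = min (\<alpha> - lo) (hi - \<alpha>) / 2"
  have \<eta>: "\<eta> > 0" "lo < \<alpha> - \<eta>" "\<alpha> + \<eta> < hi"
    using lohi unfolding \<eta>_def by (auto simp: min_def field_simps)
  have i1: "integrable lborel (\<lambda>y. exp ((\<alpha> + \<eta>) * y) * f y)" and i2: "integrable lborel (\<lambda>y. exp ((\<alpha> - \<eta>) * y) * f y)"
    using \<eta> by (auto intro!: tilt)
  show "integrable lborel (\<lambda>y. 2 / \<eta>\<^sup>2 * (\<bar>exp ((\<alpha> + \<eta>) * y) * f y\<bar> + \<bar>exp ((\<alpha> - \<eta>) * y) * f y\<bar>))"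
    using i1 i2 by (intro integrable_mult_right Bochner_Integration.integrable_add integrable_abs)
  have [measurable]: "(\<lambda>y. exp (\<alpha> * y) * f y) \<in> borel_measurable borel"
    using tilt[OF lohi] by auto
  show "(\<lambda>y. y\<^sup>2 * (exp (\<alpha> * y) * f y)) \<in> borel_measurable lborel" by measurable
  show "AE y in lborel. norm (y\<^sup>2 * (exp (\<alpha> * y) * f y))
      \<le> norm (2 / \<eta>\<^sup>2 * (\<bar>exp ((\<alpha> + \<eta>) * y) * f y\<bar> + \<bar>exp ((\<alpha> - \<eta>) * y) * f y\<bar>))"
  proof (intro AE_I2)
    fix y :: real
    have "(\<eta> * y)\<^sup>2 / 2 \<le> exp \<bar>\<eta> * y\<bar>"
      using exp_lower_Taylor_quadratic[of "\<bar>\<eta> * y\<bar>"] by simp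
    also have "\<dots> \<le> exp (\<eta> * y) + exp (- (\<eta> * y))" by (simp add: abs_if)
    finally have "y\<^sup>2 \<le> 2 / \<eta>\<^sup>2 * (exp (\<eta> * y) + exp (- (\<eta> * y)))"
      using \<eta>(1) by (simp add: field_simps power_mult_distrib)
    then have "y\<^sup>2 * (exp (\<alpha> * y) * \<bar>f y\<bar>) \<le> 2 / \<eta>\<^sup>2 * (exp (\<eta> * y) + exp (- (\<eta> * y))) * (exp (\<alpha> * y) * \<bar>f y\<bar>)"
      by (intro mult_right_mono) auto
    also have "\<dots> = 2 / \<eta>\<^sup>2 * (exp ((\<alpha> + \<eta>) * y) * \<bar>f y\<bar> + exp ((\<alpha> - \<eta>) * y) * \<bar>f y\<bar>)"
    proof -
      have "exp ((\<alpha> + \<eta>) * y) = exp (\<alpha> * y) * exp (\<eta> * y)" "exp ((\<alpha> - \<eta>) * y) = exp (\<alpha> * y) * exp (- (\<eta> * y))"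
        by (simp_all add: algebra_simps flip: exp_add)
      then show ?thesis by (simp add: algebra_simps)
    qed
    finally show "norm (y\<^sup>2 * (exp (\<alpha> * y) * f y))
      \<le> norm (2 / \<eta>\<^sup>2 * (\<bar>exp ((\<alpha> + \<eta>) * y) * f y\<bar> + \<bar>exp ((\<alpha> - \<eta>) * y) * f y\<bar>))"
      by (simp add: abs_mult)
  qed
qed

subsection \<open>The slit plane\<close>

text \<open>The angle \<open>pi / 2\<close> makes the direction \<open>i\<close> or
  \<open>- i\<close>: each cut is vertical and leads away from the real axis. As real inequalities,
  this makes openness and the later inclusions a matter of arithmetic.\<close>

lemma branch_cut_eq: "branch_cut u0 = {w. Re w = Re u0 \<and> sgn_right (Im u0) * (Im w - Im u0) > 0}"
proof (intro set_eqI iffI)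
  fix w assume "w \<in> branch_cut u0"
  then show "w \<in> {w. Re w = Re u0 \<and> sgn_right (Im u0) * (Im w - Im u0) > 0}"
    unfolding branch_cut_def half_line_def by (auto simp: cis.ctr sgn_right_def)
next
  fix w assume w: "w \<in> {w. Re w = Re u0 \<and> sgn_right (Im u0) * (Im w - Im u0) > 0}"
  define t where "t = sgn_right (Im u0) * (Im w - Im u0)"
  have "w = u0 + complex_of_real (sgn_right (Im u0)) * cis (pi / 2) * complex_of_real t" "t > 0"
    using w unfolding t_def by (auto simp: complex_eq_iff sgn_right_def)
  then show "w \<in> branch_cut u0" unfolding branch_cut_def half_line_def by blast
qed

lemma mem_slit_plane_iff:
  "w \<in> slit_plane A \<longleftrightarrow> (\<forall>u0\<in>A. Re w = Re u0 \<longrightarrow> sgn_right (Im u0) * (Im w - Im u0) < 0)"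
  unfolding slit_plane_def branch_cut_eq by (auto simp: complex_eq_iff sgn_right_def not_less)

lemma open_slit_plane:
  assumes "finite A"
  shows "open (slit_plane A)"
proof -
  have "slit_plane A = (\<Inter>u0\<in>A. - {w. Re w = Re u0 \<and> sgn_right (Im u0) * (Im w - Im u0) \<ge> 0})"
    by (rule set_eqI) (simp add: mem_slit_plane_iff not_le)
  moreover have "closed {w. Re w = Re u0 \<and> sgn_right (Im u0) * (Im w - Im u0) \<ge> 0}" for u0
    by (intro closed_Collect_conj closed_Collect_eq closed_Collect_le continuous_intros)
  ultimately show ?thesis using assms by (simp only:) (intro open_INT ballI open_Compl)
qed

lemma slit_plane_antimono: "A \<subseteq> A' \<Longrightarrow> slit_plane A' \<subseteq> slit_plane A"
  unfolding slit_plane_def by blast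

text \<open>The global factorisation treats both kinds of branch point alike: \<open>g\<close> is
  holomorphic off the cuts of the logarithmic points, each power off the cut of its own algebraic
  point, and removing all cuts leaves a common domain.\<close>

lemma has_branch_points_holomorphic:
  assumes Z: "has_branch_points A u \<rho> L Z" and L: "\<And>n. n \<in> A \<Longrightarrow> log_branch (u n) (L n)"
  shows "Z holomorphic_on slit_plane (u ` A)"
proof -
  obtain T g where T: "T \<subseteq> A" "g holomorphic_on slit_plane (u ` T)"
    and eq: "\<And>w. w \<in> slit_plane (u ` A) \<Longrightarrow> Z w = g w * (\<Prod>n\<in>A - T. branch_power (L n) (- \<rho> n) w)"
    using Z unfolding has_branch_points_def by blast
  have "g holomorphic_on slit_plane (u ` A)"
    using T by (intro holomorphic_on_subset[OF T(2)] slit_plane_antimono) auto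
  moreover have "(\<lambda>w. \<Prod>n\<in>A - T. branch_power (L n) (- \<rho> n) w) holomorphic_on slit_plane (u ` A)"
  proof (rule holomorphic_on_prod)
    fix n assume n: "n \<in> A - T"
    then have "L n holomorphic_on slit_plane {u n}" using L unfolding log_branch_def by simp
    moreover have "slit_plane (u ` A) \<subseteq> slit_plane {u n}" using n by (intro slit_plane_antimono) simp
    ultimately have "L n holomorphic_on slit_plane (u ` A)" by (rule holomorphic_on_subset)
    then show "branch_power (L n) (- \<rho> n) holomorphic_on slit_plane (u ` A)"
      unfolding branch_power_def by (intro holomorphic_on_exp' holomorphic_on_mult holomorphic_on_const)
  qed
  ultimately have "(\<lambda>w. g w * (\<Prod>n\<in>A - T. branch_power (L n) (- \<rho> n) w)) holomorphic_on slit_plane (u ` A)"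
    by (rule holomorphic_on_mult)
  then show ?thesis by (rule holomorphic_transform) (simp add: eq)
qed

subsection \<open>Asymptotics of the Shannon coefficients\<close>

text \<open>With \<open>t = s - \<mu>\<close> the argument of the sinc is
  \<open>c * (t - y)\<close>. In the remainder of the expansion of \<open>1 / (t - y)\<close>, the
  term linear in \<open>t\<close> uses \<open>|sin| \<le> 1\<close>, while the quadratic one uses
  \<open>|sin x| \<le> |x|\<close> to cancel the singular factor \<open>t - y\<close>.\<close>

lemma shannon_scaling_expansion:
  fixes m k :: int and s \<mu> :: real
  defines "y \<equiv> real_of_int k / 2 powi m - \<mu>"
  assumes y: "y \<noteq> 0"
  shows "\<bar>shannon_scaling m k s + 2 powr (- (real_of_int m / 2)) * sin (pi * (2 powi m * s - real_of_int k)) / (pi * y)\<bar>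
     \<le> 2 powr (- (real_of_int m / 2)) * (\<bar>s - \<mu>\<bar> / pi + 2 powi m * (s - \<mu>)\<^sup>2) / y\<^sup>2"
proof -
  define c where "c = (2::real) powi m"
  define d where "d = (2::real) powr (- (real_of_int m / 2))"
  define t where "t = s - \<mu>"
  define \<sigma> where "\<sigma> = sin (pi * (c * s - real_of_int k))"
  have c: "c > 0" unfolding c_def by simp
  have d: "d > 0" unfolding d_def by simp
  have dd: "2 powr (real_of_int m / 2) = d * c"
  proof -
    have "c = 2 powr (real_of_int m)" unfolding c_def by (simp add: powr_real_of_int')
    then show ?thesis unfolding d_def by (simp flip: powr_add)
  qed
  have arg: "c * s - real_of_int k = c * (t - y)"
    unfolding t_def y_def c_def[symmetric] using c by (simp add: field_simps)
  have \<sigma>1: "\<bar>\<sigma>\<bar> \<le> 1" unfolding \<sigma>_def by simp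
  have phi: "shannon_scaling m k s = d * c * nsinc (c * (t - y))"
    unfolding shannon_scaling_def dd c_def[symmetric] arg by simp
  have main: "\<bar>d * c * nsinc (c * (t - y)) + d * \<sigma> / (pi * y)\<bar> \<le> d * (\<bar>t\<bar> / pi + c * t\<^sup>2) / y\<^sup>2"
  proof (cases "t = y")
    \<comment> \<open>Here the sinc takes its value 1 at 0 and the sine vanishes; the term
      \<open>c * t\<^sup>2\<close> of the bound alone suffices.\<close>
    case True
    have "\<sigma> = 0" unfolding \<sigma>_def arg using True by simp
    then show ?thesis using True y c d by (simp add: nsinc_def abs_mult field_simps)
  next
    case False
    have \<sigma>2: "\<bar>\<sigma>\<bar> \<le> pi * c * \<bar>t - y\<bar>"
      using abs_sin_x_le_abs_x[of "pi * (c * (t - y))"] c unfolding \<sigma>_def arg by (simp add: abs_mult)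
    have "d * c * nsinc (c * (t - y)) + d * \<sigma> / (pi * y)
        = d * (- \<sigma> * t / pi + \<sigma> * t\<^sup>2 / (pi * (t - y))) / y\<^sup>2"
      using False y c unfolding nsinc_def \<sigma>_def arg
      by (simp add: field_simps power2_eq_square)
    also have "\<bar>\<dots>\<bar> = d * \<bar>- \<sigma> * t / pi + \<sigma> * t\<^sup>2 / (pi * (t - y))\<bar> / y\<^sup>2"
      using d by (simp add: abs_mult)
    also have "\<dots> \<le> d * (\<bar>t\<bar> / pi + c * t\<^sup>2) / y\<^sup>2"
    proof -
      have "\<bar>- \<sigma> * t / pi\<bar> \<le> \<bar>t\<bar> / pi"
        using mult_right_mono[OF \<sigma>1, of "\<bar>t\<bar>"] by (simp add: abs_mult divide_right_mono)
      moreover have "\<bar>\<sigma> * t\<^sup>2 / (pi * (t - y))\<bar> \<le> c * t\<^sup>2"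
        using mult_right_mono[OF \<sigma>2, of "t\<^sup>2"] False
        by (simp add: abs_mult divide_le_eq mult_ac)
      ultimately have "\<bar>- \<sigma> * t / pi + \<sigma> * t\<^sup>2 / (pi * (t - y))\<bar> \<le> \<bar>t\<bar> / pi + c * t\<^sup>2"
        by (rule order_trans[OF abs_triangle_ineq add_mono])
      then show ?thesis using d
        by (intro divide_right_mono mult_left_mono) simp_all
    qed
    finally show ?thesis .
  qed
  then show ?thesis unfolding phi unfolding c_def[symmetric] d_def[symmetric] t_def[symmetric] \<sigma>_def by simp
qed

lemma measurable_shannon_scaling [measurable]: "shannon_scaling m k \<in> borel_measurable borel"
  unfolding shannon_scaling_def nsinc_def by measurable

lemma Im_fourier_of_real:
  assumes g: "integrable lborel g"
  shows "Im (fourier g (complex_of_real x)) = - (LINT s|lborel. g s * sin (x * s))"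
proof -
  have gm [measurable]: "g \<in> borel_measurable borel" using g by auto
  have eq: "complex_of_real (g s) * exp (- (\<i> * complex_of_real x * complex_of_real s))
        = complex_of_real (g s) * cis (- (x * s))" for s
    by (simp add: cis_conv_exp mult.assoc)
  have int: "integrable lborel (\<lambda>s. complex_of_real (g s) * cis (- (x * s)))"
    by (rule Bochner_Integration.integrable_bound[OF g])
       (auto simp: norm_mult cis_conv_exp)
  have "Im (fourier g (complex_of_real x)) = (LINT s|lborel. Im (complex_of_real (g s) * cis (- (x * s))))"
    unfolding fourier_def eq by (rule integral_Im[symmetric, OF int])
  then show ?thesis by simp
qed

lemma shannon_coeff_bound:
  fixes g :: "real \<Rightarrow> real" and m :: int and \<mu> :: real
  defines "y \<equiv> \<lambda>k. real_of_int k / 2 powi m - \<mu>"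
  assumes g: "integrable lborel g" and g2: "integrable lborel (\<lambda>s. s\<^sup>2 * g s)"
  shows "\<exists>K. \<forall>k. y k \<noteq> 0 \<longrightarrow> \<bar>shannon_coeff m k g\<bar> \<le>
    2 powr (- (real_of_int m / 2)) * (1 / pi * \<bar>Im (fourier g (complex_of_real (2 powi m * pi)))\<bar> / \<bar>y k\<bar>)
      + K / (y k)\<^sup>2"
proof -
  define d where "d = (2::real) powr (- (real_of_int m / 2))"
  define c where "c = (2::real) powi m"
  have c: "c > 0" unfolding c_def by simp
  have d: "d > 0" unfolding d_def by simp
  have gm [measurable]: "g \<in> borel_measurable borel" using g by auto
  \<comment> \<open>The remainder of the expansion times \<open>y\<^sup>2\<close>, weighted by
    \<open>|g|\<close>. It does not depend on \<open>k\<close>, so its integral is the constant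
    \<open>K\<close>.\<close>
  define w where "w = (\<lambda>s. \<bar>g s\<bar> * (d * (\<bar>s - \<mu>\<bar> / pi + c * (s - \<mu>)\<^sup>2)))"
  have wint: "integrable lborel w"
  proof (rule Bochner_Integration.integrable_bound)
    show "integrable lborel (\<lambda>s. d * (1 + (c + 1) * (2 * \<mu>\<^sup>2)) * \<bar>g s\<bar> + d * (c + 1) * 2 * \<bar>s\<^sup>2 * g s\<bar>)"
      using g g2 by (intro Bochner_Integration.integrable_add integrable_mult_right integrable_abs)
    show "w \<in> borel_measurable lborel" unfolding w_def by measurable
    have "norm (w s) \<le> norm (d * (1 + (c + 1) * (2 * \<mu>\<^sup>2)) * \<bar>g s\<bar> + d * (c + 1) * 2 * \<bar>s\<^sup>2 * g s\<bar>)" for s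
    proof -
      have sq: "x \<le> 1 + x\<^sup>2" if "x \<ge> 0" for x :: real
        using sum_squares_bound[of x 1] that by simp
      have "\<bar>s - \<mu>\<bar> / pi \<le> \<bar>s - \<mu>\<bar>"
        using mult_left_mono[of 1 pi "\<bar>s - \<mu>\<bar>"] pi_gt3 by (simp add: divide_le_eq)
      also have "\<dots> \<le> 1 + (s - \<mu>)\<^sup>2"
        using sq[of "\<bar>s - \<mu>\<bar>"] by simp
      finally have "\<bar>s - \<mu>\<bar> / pi + c * (s - \<mu>)\<^sup>2 \<le> 1 + (c + 1) * (s - \<mu>)\<^sup>2"
        by (simp add: algebra_simps)
      also have "\<dots> \<le> 1 + (c + 1) * (2 * s\<^sup>2 + 2 * \<mu>\<^sup>2)"
        using c zero_le_power2[of "s + \<mu>"]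
        by (intro add_left_mono mult_left_mono) (auto simp: power2_eq_square algebra_simps)
      finally have "\<bar>g s\<bar> * (d * (\<bar>s - \<mu>\<bar> / pi + c * (s - \<mu>)\<^sup>2)) \<le> \<bar>g s\<bar> * (d * (1 + (c + 1) * (2 * s\<^sup>2 + 2 * \<mu>\<^sup>2)))"
        using d by (intro mult_left_mono) auto
      also have "\<dots> = d * (1 + (c + 1) * (2 * \<mu>\<^sup>2)) * \<bar>g s\<bar> + d * (c + 1) * 2 * \<bar>s\<^sup>2 * g s\<bar>"
        by (simp add: abs_mult algebra_simps)
      finally show ?thesis
        using c d unfolding w_def by (simp add: abs_mult)
    qed
    then show "AE s in lborel. norm (w s) \<le> norm (d * (1 + (c + 1) * (2 * \<mu>\<^sup>2)) * \<bar>g s\<bar> + d * (c + 1) * 2 * \<bar>s\<^sup>2 * g s\<bar>)"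
      by simp
  qed
  define E where "E = \<bar>Im (fourier g (complex_of_real (c * pi)))\<bar>"
  have "\<bar>shannon_coeff m k g\<bar> \<le> d * (1 / pi * E / \<bar>y k\<bar>) + integral\<^sup>L lborel w / (y k)\<^sup>2" if y: "y k \<noteq> 0" for k
  proof -
    define \<sigma> where "\<sigma> = (\<lambda>s. sin (pi * (c * s - real_of_int k)))"
    define \<phi> where "\<phi> = (\<lambda>s. shannon_scaling m k s + d * \<sigma> s / (pi * y k))"
    have [measurable]: "\<sigma> \<in> borel_measurable borel" "\<phi> \<in> borel_measurable borel"
      unfolding \<phi>_def \<sigma>_def by measurable
    have bnd: "norm (g s * \<phi> s) \<le> w s / (y k)\<^sup>2" for s
    proof -
      have "\<bar>\<phi> s\<bar> \<le> d * (\<bar>s - \<mu>\<bar> / pi + c * (s - \<mu>)\<^sup>2) / (y k)\<^sup>2"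
        using shannon_scaling_expansion[of k m \<mu> s] y
        unfolding \<phi>_def \<sigma>_def c_def d_def y_def by simp
      from mult_left_mono[OF this, of "\<bar>g s\<bar>"] show ?thesis
        unfolding w_def by (simp add: abs_mult)
    qed
    have wi: "integrable lborel (\<lambda>s. w s / (y k)\<^sup>2)" using wint by simp
    have i1: "integrable lborel (\<lambda>s. g s * \<phi> s)"
      by (rule Bochner_Integration.integrable_bound[OF wi]) (auto intro!: AE_I2 order_trans[OF bnd[unfolded real_norm_def]] divide_right_mono)
    have i2: "integrable lborel (\<lambda>s. g s * \<sigma> s)"
      by (rule Bochner_Integration.integrable_bound[OF g])
         (auto intro!: AE_I2 mult_left_le simp: \<sigma>_def abs_mult)
    have "shannon_coeff m k g = (LINT s|lborel. g s * \<phi> s - d / (pi * y k) * (g s * \<sigma> s))"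
      unfolding shannon_coeff_def by (rule arg_cong[where f="integral\<^sup>L lborel"]) (simp add: \<phi>_def algebra_simps)
    also have "\<dots> = (LINT s|lborel. g s * \<phi> s) - d / (pi * y k) * (LINT s|lborel. g s * \<sigma> s)"
      using i1 i2 by simp
    finally have D: "shannon_coeff m k g = \<dots>" .
    have "\<bar>LINT s|lborel. g s * \<phi> s\<bar> \<le> (LINT s|lborel. w s / (y k)\<^sup>2)"
      using Bochner_Integration.integral_norm_bound_integral[OF i1 wi] bnd by simp
    then have A: "\<bar>LINT s|lborel. g s * \<phi> s\<bar> \<le> integral\<^sup>L lborel w / (y k)\<^sup>2" by simp
    \<comment> \<open>As \<open>k\<close> is an integer, the shift by \<open>pi * k\<close> only
      contributes the sign \<open>cos (pi * k)\<close>, so the leading term has the same modulus for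
      all \<open>k\<close>, apart from \<open>1 / |y k|\<close>.\<close>
    have \<sigma>: "\<sigma> s = cos (pi * real_of_int k) * sin (c * pi * s)" for s
    proof -
      have "pi * (c * s - real_of_int k) = c * pi * s - pi * real_of_int k" by (simp add: algebra_simps)
      then show ?thesis unfolding \<sigma>_def by (simp only: sin_diff) (simp only: sin_npi_int, simp)
    qed
    have "(LINT s|lborel. g s * \<sigma> s) = cos (pi * real_of_int k) * (LINT s|lborel. g s * sin (c * pi * s))"
      unfolding \<sigma> by (subst integral_mult_right_zero[symmetric]) (simp only: mult_ac)
    then have B: "\<bar>LINT s|lborel. g s * \<sigma> s\<bar> = E"
      unfolding E_def Im_fourier_of_real[OF g] by (simp add: abs_mult)
    have "\<bar>d / (pi * y k) * (LINT s|lborel. g s * \<sigma> s)\<bar> = d * (1 / pi * E / \<bar>y k\<bar>)"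
      unfolding abs_mult B using d by (simp add: abs_mult)
    then show ?thesis unfolding D using A by linarith
  qed
  then show ?thesis unfolding E_def c_def d_def by blast
qed

section \<open>Boundedness on a sector, and the main result\<close>

text \<open>The half-lines starting at far real points sweep out a sector, so suprema eventually
  below 1 bound \<open>F\<close> there. A half-line excludes its starting point
  (\<open>t > 0\<close>), hence \<open>Im w \<noteq> 0\<close>; since \<open>sgn_right\<close> is 1
  at 0, both families point upwards.\<close>

lemma half_line_decay_sector:
  fixes F :: "complex \<Rightarrow> complex" and \<theta> :: real
  assumes \<theta>: "0 < \<theta>" "\<theta> < pi / 2"
    and right: "((\<lambda>R::real. SUP w\<in>half_line (complex_of_real R) \<theta>.
          ennreal (cmod (F w) + cmod (F (- w)))) \<longlongrightarrow> 0) at_top"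
    and left: "((\<lambda>R::real. SUP w\<in>half_line (complex_of_real (- R)) (pi - \<theta>).
          ennreal (cmod (F w) + cmod (F (- w)))) \<longlongrightarrow> 0) at_top"
  shows "\<exists>T. \<forall>w. Im w \<noteq> 0 \<longrightarrow> \<bar>Im w\<bar> < tan \<theta> * (\<bar>Re w\<bar> - T) \<longrightarrow> cmod (F w) \<le> 1"
proof -
  have "\<forall>\<^sub>F R in at_top. (SUP w\<in>half_line (complex_of_real R) \<theta>. ennreal (cmod (F w) + cmod (F (- w)))) < 1 \<and>
      (SUP w\<in>half_line (complex_of_real (- R)) (pi - \<theta>). ennreal (cmod (F w) + cmod (F (- w)))) < 1"
    using order_tendstoD(2)[OF right, of 1] order_tendstoD(2)[OF left, of 1]
    by (intro eventually_conj) simp_all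
  then obtain T where T: "\<And>R. R \<ge> T \<Longrightarrow> (SUP w\<in>half_line (complex_of_real R) \<theta>. ennreal (cmod (F w) + cmod (F (- w)))) < 1"
    "\<And>R. R \<ge> T \<Longrightarrow> (SUP w\<in>half_line (complex_of_real (- R)) (pi - \<theta>). ennreal (cmod (F w) + cmod (F (- w)))) < 1"
    unfolding eventually_at_top_linorder by blast
  have le1: "cmod (F z) \<le> 1 \<and> cmod (F (- z)) \<le> 1"
    if "z \<in> A" "(SUP w\<in>A. ennreal (cmod (F w) + cmod (F (- w)))) < 1" for z A
  proof -
    have "ennreal (cmod (F z) + cmod (F (- z))) < 1"
      using SUP_upper[OF that(1), of "\<lambda>w. ennreal (cmod (F w) + cmod (F (- w)))"] that(2) by (rule le_less_trans)
    then have "cmod (F z) + cmod (F (- z)) < 1" by (metis add_nonneg_nonneg ennreal_1 ennreal_less_iff norm_ge_zero)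
    then show ?thesis using norm_ge_zero[of "F z"] norm_ge_zero[of "F (- z)"] by linarith
  qed
  have sc: "sin \<theta> > 0" "cos \<theta> > 0"
    using \<theta> by (auto intro: sin_gt_zero cos_gt_zero)
  have "cmod (F w) \<le> 1" if w: "Im w \<noteq> 0" "\<bar>Im w\<bar> < tan \<theta> * (\<bar>Re w\<bar> - T)" for w
  proof -
    define v where "v = \<bar>Im w\<bar>"
    define x where "x = \<bar>Re w\<bar>"
    \<comment> \<open>The line of slope \<open>tan \<theta>\<close> through \<open>x + i v\<close>
      meets the real axis at \<open>R\<close>, and \<open>t\<close> is the distance from there. The
      hypothesis on \<open>w\<close> says exactly that this foot lies beyond
      \<open>T\<close>.\<close>
    define t where "t = v / sin \<theta>"
    define R where "R = x - cos \<theta> * t"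
    have t: "t > 0" unfolding t_def v_def using w sc by simp
    have "v * cos \<theta> < sin \<theta> * (x - T)"
      using w(2) sc unfolding v_def x_def tan_def by (simp add: field_simps)
    then have R: "R \<ge> T" unfolding R_def t_def using sc by (simp add: field_simps)
    have "Complex x v = complex_of_real R + cis \<theta> * complex_of_real t"
      using sc by (simp add: complex_eq_iff R_def t_def)
    then have p: "Complex x v \<in> half_line (complex_of_real R) \<theta>"
      unfolding half_line_def sgn_right_def using t by auto
    have "Complex (- x) v = complex_of_real (- R) + cis (pi - \<theta>) * complex_of_real t"
      using sc by (simp add: complex_eq_iff R_def t_def)
    then have q: "Complex (- x) v \<in> half_line (complex_of_real (- R)) (pi - \<theta>)"
      unfolding half_line_def sgn_right_def using t by auto
    \<comment> \<open>The values at \<open>- w\<close> in the hypotheses extend the bound to the lower half-plane.\<close>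
    have "w \<in> {Complex x v, - Complex x v, Complex (- x) v, - Complex (- x) v}"
      unfolding x_def v_def by (auto simp: complex_eq_iff abs_if)
    then show ?thesis using le1[OF p T(1)[OF R]] le1[OF q T(2)[OF R]] by auto
  qed
  then show ?thesis by blast
qed

theorem corollary3p12:
  fixes m :: int and f0 :: "real \<Rightarrow> real" and N :: nat
    and u \<rho> :: "nat \<Rightarrow> complex" and L :: "nat \<Rightarrow> complex \<Rightarrow> complex"
    and F Z H :: "complex \<Rightarrow> complex"
    and a b \<gamma>p \<gamma>m r \<alpha> \<mu> \<epsilon> :: real and M :: nat
    and f f\<alpha> :: "real \<Rightarrow> real" and y :: "int \<Rightarrow> real"
  defines "r \<equiv> 2 powi m * pi"
    and "f \<equiv> (\<lambda>x. f0 (x - \<mu>))"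
    and "f\<alpha> \<equiv> (\<lambda>x. exp (\<alpha> * x) * f x)"
    and "y \<equiv> (\<lambda>k. real_of_int k / 2 powi m - \<mu>)"
    and "\<epsilon> \<equiv> 1 / pi * \<bar>Im (fourier f\<alpha> (complex_of_real r))\<bar>"
  assumes f0_L1: "integrable lborel f0"
    and f0_C1: "piecewise (C1_on_interval f0)"
    and nonreal: "\<And>n. n \<in> {1..N} \<Longrightarrow> u n \<notin> \<real>"
    and order_nz: "\<And>n. n \<in> {1..N} \<Longrightarrow> \<rho> n \<noteq> 0"
    and logs: "\<And>n. n \<in> {1..N} \<Longrightarrow> log_branch (u n) (L n)"
    and Z_branch: "has_branch_points {1..N} u \<rho> L Z"
    and H_entire: "H holomorphic_on UNIV"
    and F_eq: "\<And>w. w \<in> slit_plane (u ` {1..N}) \<Longrightarrow> F w = Z w + H w"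
    and F_extends: "\<And>x::real. F (complex_of_real x) = fourier f0 (complex_of_real x)"
    and growth: "\<exists>C>0. \<exists>q>0. \<exists>R. \<forall>w\<in>slit_plane (u ` {1..N}).
                   cmod w \<ge> R \<longrightarrow> cmod (F w) \<le> C * (1 + cmod w powr q)"
    and decay: "\<exists>\<theta>. 0 < \<theta> \<and> \<theta> < pi / 2 \<and>
        ((\<lambda>R::real. SUP w\<in>half_line (complex_of_real R) \<theta>.
            ennreal (cmod (F w) + cmod (F (- w)))) \<longlongrightarrow> 0) at_top \<and>
        ((\<lambda>R::real. SUP w\<in>half_line (complex_of_real (- R)) (pi - \<theta>).
            ennreal (cmod (F w) + cmod (F (- w)))) \<longlongrightarrow> 0) at_top"
    and pos: "a > 0" "b > 0" "\<gamma>p > 0" "\<gamma>m > 0"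
    and upper: "\<And>n. n \<in> {1..N} \<Longrightarrow> Im (u n) > 0 \<Longrightarrow> Im (u n) \<ge> b"
    and upper_order: "\<And>n. n \<in> {1..N} \<Longrightarrow> Im (u n) = b \<Longrightarrow> Re (\<rho> n) \<le> \<gamma>p"
    and lower: "\<And>n. n \<in> {1..N} \<Longrightarrow> Im (u n) < 0 \<Longrightarrow> Im (u n) \<le> - a"
    and lower_order: "\<And>n. n \<in> {1..N} \<Longrightarrow> Im (u n) = - a \<Longrightarrow> Re (\<rho> n) \<le> \<gamma>m"
    and smooth: "Ck_on (M + 1) (\<lambda>x. fourier f0 (complex_of_real x)) {x. \<bar>x\<bar> > r}"
    and vanish: "\<And>j. j \<le> M \<Longrightarrow>
        (iter_deriv j (\<lambda>x. fourier f0 (complex_of_real x)) \<longlongrightarrow> 0) at_infinity"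
    and deriv_L1: "set_integrable lborel {x. \<bar>x\<bar> > r}
        (iter_deriv (M + 1) (\<lambda>x. fourier f0 (complex_of_real x)))"
    and alpha: "- a < \<alpha>" "\<alpha> < b"
  shows "\<exists>Cp>0. \<exists>Cm>0. \<exists>K. \<forall>k::int.
      (y k > 1 \<longrightarrow>
         \<bar>shannon_coeff m k f\<alpha>\<bar> \<le>
           2 powr (- (real_of_int m / 2)) *
             (Cp * exp (\<alpha> * \<mu>) * y k powr (\<gamma>p - 1) * exp (- (b - \<alpha>) * y k) + \<epsilon> / y k)
           + K / (y k)\<^sup>2) \<and>
      (y k < - 1 \<longrightarrow>
         \<bar>shannon_coeff m k f\<alpha>\<bar> \<le>
           2 powr (- (real_of_int m / 2)) *
             (Cm * exp (\<alpha> * \<mu>) * \<bar>y k\<bar> powr (\<gamma>m - 1) * exp (- (a + \<alpha>) * \<bar>y k\<bar>) + \<epsilon> / \<bar>y k\<bar>)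
           + K / (y k)\<^sup>2)"
proof -
  obtain \<theta> where \<theta>: "0 < \<theta>" "\<theta> < pi / 2"
    and right: "((\<lambda>R::real. SUP w\<in>half_line (complex_of_real R) \<theta>.
          ennreal (cmod (F w) + cmod (F (- w)))) \<longlongrightarrow> 0) at_top"
    and left: "((\<lambda>R::real. SUP w\<in>half_line (complex_of_real (- R)) (pi - \<theta>).
          ennreal (cmod (F w) + cmod (F (- w)))) \<longlongrightarrow> 0) at_top"
    using decay by blast
  obtain T where T: "\<And>w. Im w \<noteq> 0 \<Longrightarrow> \<bar>Im w\<bar> < tan \<theta> * (\<bar>Re w\<bar> - T) \<Longrightarrow> cmod (F w) \<le> 1"
    using half_line_decay_sector[OF \<theta> right left] by blast
  \<comment> \<open>Slope at most \<open>tan \<theta>\<close> keeps the sector where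
    \<open>F\<close> is bounded; slope at most 1 keeps the Gaussian factor bounded by 1.\<close>
  define \<kappa> where "\<kappa> = min 1 (tan \<theta>)"
  \<comment> \<open>Beyond \<open>T\<close> for the sector bound, and beyond every
    \<open>|Re (u n)|\<close> so that the vertical cuts miss the sector; the sum is a convenient
    bound for all of them, also for \<open>N = 0\<close>.\<close>
  define R0 where "R0 = \<bar>T\<bar> + (\<Sum>n\<in>{1..N}. \<bar>Re (u n)\<bar>)"
  \<comment> \<open>The half-lines contain no real points: off the real axis \<open>|F|\<close> is
    at most 1, on it at most the \<open>L^1\<close> norm of \<open>f0\<close>.\<close>
  define B where "B = 1 + (LINT s|lborel. \<bar>f0 s\<bar>)"
  have \<kappa>: "0 < \<kappa>" "\<kappa> \<le> 1" "\<kappa> \<le> tan \<theta>"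
    unfolding \<kappa>_def using tan_gt_zero[OF \<theta>] by auto
  have R0: "R0 \<ge> 0" "R0 \<ge> T" unfolding R0_def by (auto intro!: add_nonneg_nonneg sum_nonneg add_increasing2)
  have R0u: "\<bar>Re (u n)\<bar> \<le> R0" if "n \<in> {1..N}" for n
    using member_le_sum[OF that, of "\<lambda>n. \<bar>Re (u n)\<bar>"] unfolding R0_def by simp
  have holF: "F holomorphic_on slit_plane (u ` {1..N})"
  proof (rule holomorphic_transform)
    show "(\<lambda>w. Z w + H w) holomorphic_on slit_plane (u ` {1..N})"
      using has_branch_points_holomorphic[OF Z_branch logs] H_entire
      by (intro holomorphic_on_add) (auto intro: holomorphic_on_subset)
  qed (simp add: F_eq)
  \<comment> \<open>The cuts start at heights at least \<open>b\<close> or at most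
    \<open>- a\<close> and lead away from the real axis, so none of them enters the strip.\<close>
  have strip: "F holomorphic_on {w. - a < Im w \<and> Im w < b}"
  proof (rule holomorphic_on_subset[OF holF])
    show "{w. - a < Im w \<and> Im w < b} \<subseteq> slit_plane (u ` {1..N})"
    proof
      fix w assume w: "w \<in> {w. - a < Im w \<and> Im w < b}"
      have "sgn_right (Im (u n)) * (Im w - Im (u n)) < 0" if n: "n \<in> {1..N}" for n
      proof -
        have "Im (u n) \<noteq> 0" using nonreal[OF n] by (simp add: complex_is_Real_iff)
        then show ?thesis using upper[OF n] lower[OF n] w by (cases "Im (u n) > 0") (auto simp: sgn_right_def)
      qed
      then show "w \<in> slit_plane (u ` {1..N})" unfolding mem_slit_plane_iff by blast
    qed
  qed
  have pos_sector: "R0 < \<bar>Re w\<bar>" if "\<bar>Im w\<bar> < \<kappa> * (\<bar>Re w\<bar> - R0)" for w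
    using le_less_trans[OF abs_ge_zero that] \<kappa>(1) by (simp add: zero_less_mult_iff)
  have sector: "F holomorphic_on {w. \<bar>Im w\<bar> < \<kappa> * (\<bar>Re w\<bar> - R0)}"
  proof (rule holomorphic_on_subset[OF holF])
    show "{w. \<bar>Im w\<bar> < \<kappa> * (\<bar>Re w\<bar> - R0)} \<subseteq> slit_plane (u ` {1..N})"
    proof
      fix w assume "w \<in> {w. \<bar>Im w\<bar> < \<kappa> * (\<bar>Re w\<bar> - R0)}"
      then have "R0 < \<bar>Re w\<bar>" using pos_sector by simp
      then have "Re w \<noteq> Re (u n)" if "n \<in> {1..N}" for n using R0u[OF that] by auto
      then show "w \<in> slit_plane (u ` {1..N})" unfolding mem_slit_plane_iff by blast
    qed
  qed
  have FB: "cmod (F w) \<le> B" if "w \<in> {w. \<bar>Im w\<bar> < \<kappa> * (\<bar>Re w\<bar> - R0)}" for w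
  proof (cases "Im w = 0")
    case True
    then have "F w = fourier f0 (complex_of_real (Re w))"
      using F_extends[of "Re w"] by (metis complex_is_Real_iff of_real_Re)
    also have "cmod \<dots> \<le> (LINT s|lborel. \<bar>f0 s\<bar>)"
      unfolding fourier_def
      by (rule order_trans[OF integral_norm_bound]) (simp add: norm_mult)
    finally show ?thesis unfolding B_def by simp
  next
    case False
    have w: "\<bar>Im w\<bar> < \<kappa> * (\<bar>Re w\<bar> - R0)" using that by simp
    also have "\<dots> \<le> tan \<theta> * (\<bar>Re w\<bar> - T)"
      using \<kappa> R0 pos_sector[OF w] by (intro mult_mono) auto
    finally have "cmod (F w) \<le> 1" by (rule T[OF False])
    also have "1 \<le> B" unfolding B_def by simp
    finally show ?thesis .
  qed
  have tilt0: "integrable lborel (\<lambda>s. exp (\<beta> * s) * f0 s)" if \<beta>: "- a < \<beta>" "\<beta> < b" for \<beta>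
  proof -
    obtain C where "\<And>s. s \<noteq> 0 \<Longrightarrow> isCont f0 s \<Longrightarrow> \<bar>f0 s\<bar> \<le> C * exp (- \<beta> * s) / s\<^sup>2"
      using tilted_density_decay[OF f0_L1 F_extends _ _ \<beta> \<kappa>(1,2) R0(1) strip sector FB] pos by auto
    then show ?thesis by (rule integrable_exp_tilt[OF f0_L1 piecewise_C1_continuous_AE[OF f0_C1]])
  qed
  have tilt: "integrable lborel (\<lambda>s. exp (\<beta> * s) * f s)" if \<beta>: "- a < \<beta>" "\<beta> < b" for \<beta>
  proof -
    \<comment> \<open>Translation by \<open>\<mu>\<close> multiplies the tilted function by the
      constant \<open>exp (\<beta> * \<mu>)\<close>, so integrability carries over from
      \<open>f0\<close> to \<open>f\<close>.\<close>
    have "integrable lborel (\<lambda>s. exp (\<beta> * \<mu>) * (exp (\<beta> * (- \<mu> + 1 * s)) * f0 (- \<mu> + 1 * s)))"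
      by (intro integrable_mult_right lborel_integrable_real_affine tilt0 \<beta>) simp
    also have "(\<lambda>s. exp (\<beta> * \<mu>) * (exp (\<beta> * (- \<mu> + 1 * s)) * f0 (- \<mu> + 1 * s))) = (\<lambda>s. exp (\<beta> * s) * f s)"
    proof
      fix s
      have "exp (\<beta> * s) = exp (\<beta> * \<mu>) * exp (\<beta> * (- \<mu> + 1 * s))"
        by (simp add: right_diff_distrib flip: exp_add)
      then show "exp (\<beta> * \<mu>) * (exp (\<beta> * (- \<mu> + 1 * s)) * f0 (- \<mu> + 1 * s)) = exp (\<beta> * s) * f s"
        unfolding f_def by simp
    qed
    finally show ?thesis .
  qed
  have f\<alpha>1: "integrable lborel f\<alpha>" unfolding f\<alpha>_def by (rule tilt[OF alpha])
  have f\<alpha>2: "integrable lborel (\<lambda>s. s\<^sup>2 * f\<alpha> s)"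
    unfolding f\<alpha>_def by (rule integrable_square_exp_tilt[OF alpha tilt])
  obtain K where K: "\<And>k. y k \<noteq> 0 \<Longrightarrow> \<bar>shannon_coeff m k f\<alpha>\<bar> \<le>
      2 powr (- (real_of_int m / 2)) * (\<epsilon> / \<bar>y k\<bar>) + K / (y k)\<^sup>2"
    using shannon_coeff_bound[OF f\<alpha>1 f\<alpha>2, of m \<mu>] unfolding y_def \<epsilon>_def r_def by blast
  have bound: "\<bar>shannon_coeff m k f\<alpha>\<bar> \<le> 2 powr (- (real_of_int m / 2)) * (p + \<epsilon> / x) + K / (y k)\<^sup>2"
    if "x = \<bar>y k\<bar>" "y k \<noteq> 0" "p \<ge> 0" for k p x
    using mult_left_mono[of "\<epsilon> / x" "p + \<epsilon> / x" "2 powr (- (real_of_int m / 2))"] K[OF that(2)] that by simp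
  \<comment> \<open>Witnesses \<open>Cp = Cm = 1\<close>: the exponential terms are nonnegative, so
    \<open>bound\<close> adds them for free in the role of \<open>p\<close>.\<close>
  have "\<forall>k. (y k > 1 \<longrightarrow> \<bar>shannon_coeff m k f\<alpha>\<bar> \<le> 2 powr (- (real_of_int m / 2)) *
        (1 * exp (\<alpha> * \<mu>) * y k powr (\<gamma>p - 1) * exp (- (b - \<alpha>) * y k) + \<epsilon> / y k) + K / (y k)\<^sup>2) \<and>
      (y k < - 1 \<longrightarrow> \<bar>shannon_coeff m k f\<alpha>\<bar> \<le> 2 powr (- (real_of_int m / 2)) *
        (1 * exp (\<alpha> * \<mu>) * \<bar>y k\<bar> powr (\<gamma>m - 1) * exp (- (a + \<alpha>) * \<bar>y k\<bar>) + \<epsilon> / \<bar>y k\<bar>) + K / (y k)\<^sup>2)"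
    by (intro allI conjI impI bound) simp_all
  then show ?thesis using zero_less_one by blast
qed

end
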